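(* Let $N\ge 2$, let $C\in M_N(\mathbb{R})$, let $f:[0,1]\to\mathbb{R}$ be strictly convex and continuous with $f\in C^2((0,1])$ and $f'(0)=-\infty$, let $\gamma>0$, and let $x,y\in\mathcal{P}_N$ with $|\mathrm{supp}\,x|=|\mathrm{supp}\,y|=N$ (all coordinates $x_i,y_j$ positive). Let $O$, $\Phi$, $\mathcal{F}$, $D$, $G$, $\epsilon$ be as defined in the context. Then for $Z\in O$ one has $Z-tD(Z)\in O$ for $t\in[0,\epsilon(Z)]$, and $$D_2(Z):=\max_{t\in[0,\epsilon(Z)]}\frac{d^2}{dt^2}\mathcal{F}^\gamma_{x,y}(\Phi(Z-tD(Z)))\ge 0,$$ with equality if and only if $D(Z)=0$. Furthermore, define $(Z^n)_{n\in\mathbb{N}}\subset O$ inductively as follows. Let $Z^1:=\Phi^{-1}(x\otimes y)$. If $Z^n\in O$ has been defined, let $Z^{n+1}:=Z^n$ if $D(Z^n)=0$, and otherwise let $$Z^{n+1}:=Z^n-t_nD(Z^n),\qquad t_n:=\min\left\{\frac{G(Z^n)}{D_2(Z^n)},\ \epsilon(Z^n)\right\}.$$ Then $Z^\infty:=\lim_{n\to\infty}Z^n$ exists and $\Phi(Z^\infty)$ is an $(f,\gamma)$-coupling between $x,y$.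
   Context: $\mathcal{P}_N=\{x\in\mathbb{R}^N: x_i\ge 0,\ \sum_i x_i=1\}$. $\Pi(x,y)$ is the set of couplings: matrices $\Pi=(\pi_{ij})\in M_N(\mathbb{R})$ with $\pi_{ij}\ge 0$, $\sum_k\pi_{ik}=x_i$, $\sum_k\pi_{kj}=y_j$. $(x\otimes y)_{ij}=x_iy_j$; $\langle C,\Pi\rangle=\sum_{i,j}c_{ij}\pi_{ij}$. $f'(0):=\lim_{\varepsilon\downarrow0}f'(\varepsilon)$. For $\Pi\in\Pi(x,y)$, $\mathcal{D}_f(\Pi,x\otimes y)=\sum_{i,j}\big(f(\pi_{ij})-f(x_iy_j)-f'(x_iy_j)(\pi_{ij}-x_iy_j)\big)$ and $\mathcal{F}^\gamma_{x,y}(\Pi)=\langle C,\Pi\rangle+\gamma\mathcal{D}_f(\Pi,x\otimes y)$. An $(f,\gamma)$-coupling between $x,y$ is a minimizer of $\mathcal{F}^\gamma_{x,y}$ over $\Pi(x,y)$. Coordinates: let $$O=\Big\{Z=(z_{ij})\in(0,1)^{(N-1)\times(N-1)}:\ \sum_{k=1}^{N-1}z_{ik}<x_i,\ \sum_{k=1}^{N-1}z_{kj}<y_j\ \text{ for }1\le i,j\le N-1\Big\},$$ and define $\Phi(Z)=(\phi_{ij}(Z))\in M_N(\mathbb{R})$ by $\phi_{ij}(Z)=z_{ij}$, $\phi_{iN}(Z)=x_i-\sum_{k=1}^{N-1}z_{ik}$, $\phi_{Nj}(Z)=y_j-\sum_{k=1}^{N-1}z_{kj}$ for $1\le i,j\le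 N-1$, and $\phi_{NN}(Z)=1-\sum_{i=1}^{N-1}x_i-\sum_{j=1}^{N-1}y_j+\sum_{i,j=1}^{N-1}z_{ij}$. Define $\mathcal{F}(Z)=\mathcal{F}^\gamma_{x,y}(\Phi(Z))$ on $O$, and $\nabla_{ij}\mathcal{F}=\partial\mathcal{F}/\partial z_{ij}$ for $1\le i,j\le N-1$. Riemannian gradient: the metric on $M=\Phi(O)$ induced from the Frobenius inner product on $M_N(\mathbb{R})$ has, in the coordinates $Z$, components $g_{(i,j)(k,l)}=(1+\delta_{ik})(1+\delta_{jl})$ with inverse $g^{(i,j)(k,l)}=(\frac1N-\delta_{ik})(\frac1N-\delta_{jl})$, $1\le i,j,k,l\le N-1$. Put $D(Z)=(d^{ij}(Z))_{1\le i,j\le N-1}$ with $d^{ij}(Z)=\sum_{k,l=1}^{N-1}g^{(i,j)(k,l)}\nabla_{kl}\mathcal{F}(Z)$ (the gradient of $\mathcal{F}^\gamma_{x,y}$ on $M$ at $\Phi(Z)$ in these coordinates), and $G(Z)=\sum_{i,j,k,l=1}^{N-1}g_{(i,j)(k,l)}d^{ij}(Z)d^{kl}(Z)$ (its squared length). Step bounds, for $Z\in O$ and $1\le i,j\le N-1$: - $\epsilon_{ij}(Z)=\dfrac{z_{ij}}{2d^{ij}(Z)}$ if $d^{ij}(Z)>0$, and $1$ otherwise; - $\epsilon^i(Z)=\dfrac{x_i-\sum_{k=1}^{N-1}z_{ik}}{-2\sum_{k=1}^{N-1}d^{ik}(Z)}$ if $\sum_{k=1}^{N-1}d^{ik}(Z)<0$,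 and $1$ otherwise; - $\epsilon_j(Z)=\dfrac{y_j-\sum_{k=1}^{N-1}z_{kj}}{-2\sum_{k=1}^{N-1}d^{kj}(Z)}$ if $\sum_{k=1}^{N-1}d^{kj}(Z)<0$, and $1$ otherwise. $\epsilon(Z)=\min_{1\le i,j\le N-1}\{\epsilon^i(Z),\epsilon_j(Z),\epsilon_{ij}(Z)\}$.
   Formalization: O additionally requires φ_NN(Z)>0, and ε(Z) also takes the minimum with φ_NN(Z)/(2Σd^{kl}(Z)) if Σd^{kl}(Z)>0 (1 otherwise); as printed, Φ(Z) can have a negative (N,N) entry, where F is undefined. If x_N+y_N≥1 nothing changes. *)

theory Defs
  imports "HOL-Analysis.Analysis"
begin

text \<open>
  Index sets. The size \<open>N\<close> and its predecessor \<open>N - 1\<close> both occur. The finite type \<open>'n\<close> stands for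
  \<open>{1, \<dots>, N - 1}\<close> and \<open>'n option\<close> for \<open>{1, \<dots>, N}\<close>, where \<open>Some i\<close> is the index \<open>i < N\<close> and \<open>None\<close> is
  the index \<open>N\<close>. Thus \<open>N = CARD('n option) = CARD('n) + 1\<close>, and as \<open>'n\<close> ranges over all (nonempty)
  finite types, \<open>N\<close> ranges over all integers \<open>\<ge> 2\<close>.
\<close>

definition prob_simplex :: "(real ^ 'm) set" where
  "prob_simplex = {x. (\<forall>i. 0 \<le> x $ i) \<and> (\<Sum>i\<in>UNIV. x $ i) = 1}"

definition supp :: "real ^ 'm \<Rightarrow> 'm set" where
  "supp x = {i. 0 < x $ i}"

definition couplings :: "real ^ 'm \<Rightarrow> real ^ 'm \<Rightarrow> (real ^ 'm ^ 'm) set" where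
  "couplings x y = {P. (\<forall>i j. 0 \<le> P $ i $ j) \<and>
      (\<forall>i. (\<Sum>k\<in>UNIV. P $ i $ k) = x $ i) \<and> (\<forall>j. (\<Sum>k\<in>UNIV. P $ k $ j) = y $ j)}"

definition outer :: "real ^ 'm \<Rightarrow> real ^ 'm \<Rightarrow> real ^ 'm ^ 'm" where
  "outer x y = (\<chi> i j. x $ i * y $ j)"

definition strictly_convex_on :: "real set \<Rightarrow> (real \<Rightarrow> real) \<Rightarrow> bool" where
  "strictly_convex_on S f \<longleftrightarrow> convex S \<and>
     (\<forall>u\<in>S. \<forall>v\<in>S. \<forall>t. u \<noteq> v \<longrightarrow> 0 < t \<longrightarrow> t < 1 \<longrightarrow>
        f ((1 - t) * u + t * v) < (1 - t) * f u + t * f v)"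

definition C2_on :: "real set \<Rightarrow> (real \<Rightarrow> real) \<Rightarrow> bool" where
  "C2_on S f \<longleftrightarrow> (\<exists>f' f''.
     (\<forall>u\<in>S. (f has_real_derivative f' u) (at u within S)) \<and>
     (\<forall>u\<in>S. (f' has_real_derivative f'' u) (at u within S)) \<and> continuous_on S f'')"

text \<open>
  A function on \<open>[0,1]\<close> is represented by a function on the reals whose values outside \<open>[0,1]\<close>
  are unconstrained and irrelevant; hence the derivative is taken within \<open>[0,1]\<close> (two-sided on \<open>(0,1)\<close>,
  one-sided at the end points). For continuous \<open>f\<close> with \<open>lim f'(\<epsilon>)\<close> finite as \<open>\<epsilon> \<down> 0\<close>, its value at
  \<open>0\<close> is that limit; if the limit is \<open>-\<infinity>\<close> the value at \<open>0\<close> is meaningless, but it is never used when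
  all \<open>x\<^sub>i\<close> and \<open>y\<^sub>j\<close> are positive.
\<close>

definition deriv01 :: "(real \<Rightarrow> real) \<Rightarrow> real \<Rightarrow> real" where
  "deriv01 f u = vector_derivative f (at u within {0..1})"

definition bregman :: "(real \<Rightarrow> real) \<Rightarrow> real ^ 'm ^ 'm \<Rightarrow> real ^ 'm ^ 'm \<Rightarrow> real" where
  "bregman f P Q = (\<Sum>i\<in>UNIV. \<Sum>j\<in>UNIV.
     f (P $ i $ j) - f (Q $ i $ j) - deriv01 f (Q $ i $ j) * (P $ i $ j - Q $ i $ j))"

definition cost ::
  "(real \<Rightarrow> real) \<Rightarrow> real \<Rightarrow> real ^ 'm ^ 'm \<Rightarrow> real ^ 'm \<Rightarrow> real ^ 'm \<Rightarrow> real ^ 'm ^ 'm \<Rightarrow> real" where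
  "cost f \<gamma> C x y P =
     (\<Sum>i\<in>UNIV. \<Sum>j\<in>UNIV. C $ i $ j * P $ i $ j) + \<gamma> * bregman f P (outer x y)"

definition is_f_coupling ::
  "(real \<Rightarrow> real) \<Rightarrow> real \<Rightarrow> real ^ 'm ^ 'm \<Rightarrow> real ^ 'm \<Rightarrow> real ^ 'm \<Rightarrow> real ^ 'm ^ 'm \<Rightarrow> bool" where
  "is_f_coupling f \<gamma> C x y P \<longleftrightarrow> is_arg_min (cost f \<gamma> C x y) (\<lambda>Q. Q \<in> couplings x y) P"


definition Phi ::
  "real ^ 'n option \<Rightarrow> real ^ 'n option \<Rightarrow> real ^ 'n ^ 'n \<Rightarrow> real ^ 'n option ^ 'n option" where
  "Phi x y Z = (\<chi> i j. case i of
      Some i' \<Rightarrow> (case j of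
          Some j' \<Rightarrow> Z $ i' $ j'
        | None \<Rightarrow> x $ Some i' - (\<Sum>k\<in>UNIV. Z $ i' $ k))
    | None \<Rightarrow> (case j of
          Some j' \<Rightarrow> y $ Some j' - (\<Sum>k\<in>UNIV. Z $ k $ j')
        | None \<Rightarrow> 1 - (\<Sum>k\<in>UNIV. x $ Some k) - (\<Sum>k\<in>UNIV. y $ Some k)
                    + (\<Sum>k\<in>UNIV. \<Sum>l\<in>UNIV. Z $ k $ l)))"

text \<open>
  The last condition, positivity of the \<open>(N,N)\<close> entry of \<open>Phi x y Z\<close>, does not follow from the others
  (unless \<open>x\<^sub>N + y\<^sub>N \<ge> 1\<close>). It is needed for \<open>Phi x y Z\<close> to be a coupling, hence for the entries to
  lie in the domain \<open>[0,1]\<close> of \<open>f\<close>: for \<open>x, y\<close> in the simplex, the set below is exactly the set of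
  coordinates of the couplings with positive entries.
\<close>

definition coord_domain :: "real ^ 'n option \<Rightarrow> real ^ 'n option \<Rightarrow> (real ^ 'n ^ 'n) set" where
  "coord_domain x y = {Z.
     (\<forall>i j. 0 < Z $ i $ j \<and> Z $ i $ j < 1) \<and>
     (\<forall>i. (\<Sum>k\<in>UNIV. Z $ i $ k) < x $ Some i) \<and>
     (\<forall>j. (\<Sum>k\<in>UNIV. Z $ k $ j) < y $ Some j) \<and>
     0 < Phi x y Z $ None $ None}"

definition coord_cost ::
  "(real \<Rightarrow> real) \<Rightarrow> real \<Rightarrow> real ^ 'n option ^ 'n option \<Rightarrow> real ^ 'n option \<Rightarrow> real ^ 'n option
     \<Rightarrow> real ^ 'n ^ 'n \<Rightarrow> real" where
  "coord_cost f \<gamma> C x y Z = cost f \<gamma> C x y (Phi x y Z)"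

definition partial :: "(real ^ 'n ^ 'n \<Rightarrow> real) \<Rightarrow> real ^ 'n ^ 'n \<Rightarrow> 'n \<Rightarrow> 'n \<Rightarrow> real" where
  "partial F Z i j = deriv (\<lambda>s. F (Z + s *\<^sub>R axis i (axis j 1))) 0"

definition kdelta :: "'n \<Rightarrow> 'n \<Rightarrow> real" where
  "kdelta i k = (if i = k then 1 else 0)"

definition metric :: "'n \<Rightarrow> 'n \<Rightarrow> 'n \<Rightarrow> 'n \<Rightarrow> real" where
  "metric i j k l = (1 + kdelta i k) * (1 + kdelta j l)"

definition inv_metric :: "'n::finite \<Rightarrow> 'n \<Rightarrow> 'n \<Rightarrow> 'n \<Rightarrow> real" where
  "inv_metric i j k l =
     (1 / real CARD('n option) - kdelta i k) * (1 / real CARD('n option) - kdelta j l)"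

definition rgrad ::
  "(real \<Rightarrow> real) \<Rightarrow> real \<Rightarrow> real ^ 'n option ^ 'n option \<Rightarrow> real ^ 'n option \<Rightarrow> real ^ 'n option
     \<Rightarrow> real ^ 'n ^ 'n \<Rightarrow> real ^ 'n ^ 'n" where
  "rgrad f \<gamma> C x y Z = (\<chi> i j.
     \<Sum>k\<in>UNIV. \<Sum>l\<in>UNIV. inv_metric i j k l * partial (coord_cost f \<gamma> C x y) Z k l)"

definition sqlen ::
  "(real \<Rightarrow> real) \<Rightarrow> real \<Rightarrow> real ^ 'n option ^ 'n option \<Rightarrow> real ^ 'n option \<Rightarrow> real ^ 'n option
     \<Rightarrow> real ^ 'n ^ 'n \<Rightarrow> real" where
  "sqlen f \<gamma> C x y Z = (\<Sum>i\<in>UNIV. \<Sum>j\<in>UNIV. \<Sum>k\<in>UNIV. \<Sum>l\<in>UNIV.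
     metric i j k l * rgrad f \<gamma> C x y Z $ i $ j * rgrad f \<gamma> C x y Z $ k $ l)"

text \<open>
  Step bounds at \<open>Z\<close> for an arbitrary direction \<open>D\<close>. In the order of the definitions, they keep
  \<open>Z - t D\<close> away from the boundary as regards the entries \<open>(i,j)\<close>, \<open>(i,N)\<close>, \<open>(N,j)\<close> and \<open>(N,N)\<close> of the
  coupling.
\<close>

definition eps_entry :: "real ^ 'n ^ 'n \<Rightarrow> real ^ 'n ^ 'n \<Rightarrow> 'n \<Rightarrow> 'n \<Rightarrow> real" where
  "eps_entry Z D i j = (if D $ i $ j > 0 then Z $ i $ j / (2 * D $ i $ j) else 1)"

definition eps_row :: "real ^ 'n option \<Rightarrow> real ^ 'n ^ 'n \<Rightarrow> real ^ 'n ^ 'n \<Rightarrow> 'n \<Rightarrow> real" where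
  "eps_row x Z D i =
     (if (\<Sum>k\<in>UNIV. D $ i $ k) < 0
      then (x $ Some i - (\<Sum>k\<in>UNIV. Z $ i $ k)) / (- 2 * (\<Sum>k\<in>UNIV. D $ i $ k)) else 1)"

definition eps_col :: "real ^ 'n option \<Rightarrow> real ^ 'n ^ 'n \<Rightarrow> real ^ 'n ^ 'n \<Rightarrow> 'n \<Rightarrow> real" where
  "eps_col y Z D j =
     (if (\<Sum>k\<in>UNIV. D $ k $ j) < 0
      then (y $ Some j - (\<Sum>k\<in>UNIV. Z $ k $ j)) / (- 2 * (\<Sum>k\<in>UNIV. D $ k $ j)) else 1)"

text \<open>
  The bound for the entry \<open>(N,N)\<close>, which changes by \<open>-t \<Sum>\<^sub>k\<^sub>l d\<^sup>k\<^sup>l\<close>. It is the counterpart of the last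
  condition in \<open>coord_domain\<close>; without it the segment may leave the set of couplings. If
  \<open>x\<^sub>N + y\<^sub>N \<ge> 1\<close>, it is implied by the bounds \<open>eps_entry\<close> and does not affect the minimum below.
\<close>

definition eps_corner ::
  "real ^ 'n option \<Rightarrow> real ^ 'n option \<Rightarrow> real ^ 'n ^ 'n \<Rightarrow> real ^ 'n ^ 'n \<Rightarrow> real" where
  "eps_corner x y Z D =
     (if (\<Sum>k\<in>UNIV. \<Sum>l\<in>UNIV. D $ k $ l) > 0
      then Phi x y Z $ None $ None / (2 * (\<Sum>k\<in>UNIV. \<Sum>l\<in>UNIV. D $ k $ l)) else 1)"

definition eps ::
  "(real \<Rightarrow> real) \<Rightarrow> real \<Rightarrow> real ^ 'n option ^ 'n option \<Rightarrow> real ^ 'n option \<Rightarrow> real ^ 'n option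
     \<Rightarrow> real ^ 'n ^ 'n \<Rightarrow> real" where
  "eps f \<gamma> C x y Z = (let D = rgrad f \<gamma> C x y Z in
     Min (range (eps_row x Z D) \<union> range (eps_col y Z D)
          \<union> range (\<lambda>(i, j). eps_entry Z D i j) \<union> {eps_corner x y Z D}))"

lemma Phi_corner:
  fixes x y :: "real ^ ('n::finite) option"
  assumes "x \<in> prob_simplex" "y \<in> prob_simplex"
  shows "Phi x y Z $ None $ None = x $ None + y $ None - 1 + (\<Sum>k\<in>UNIV. \<Sum>l\<in>UNIV. Z $ k $ l)"
proof -
  have *: "(\<Sum>k\<in>UNIV. v $ Some k) = 1 - v $ None" if "v \<in> prob_simplex" for v :: "real ^ 'n option"
  proof -
    have "(\<Sum>i\<in>UNIV. v $ i) = v $ None + (\<Sum>k\<in>UNIV. v $ Some k)"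
      by (simp add: UNIV_option_conv sum.reindex)
    then show ?thesis using that by (simp add: prob_simplex_def)
  qed
  show ?thesis using *[OF assms(1)] *[OF assms(2)] by (simp add: Phi_def)
qed

text \<open>
  If \<open>x\<^sub>N + y\<^sub>N \<ge> 1\<close>, the two conditions on the entry \<open>(N,N)\<close> are redundant.
\<close>

lemma coord_domain_corner_redundant:
  fixes x y :: "real ^ ('n::finite) option"
  assumes "x \<in> prob_simplex" "y \<in> prob_simplex" "1 \<le> x $ None + y $ None"
  shows "coord_domain x y = {Z.
     (\<forall>i j. 0 < Z $ i $ j \<and> Z $ i $ j < 1) \<and>
     (\<forall>i. (\<Sum>k\<in>UNIV. Z $ i $ k) < x $ Some i) \<and>
     (\<forall>j. (\<Sum>k\<in>UNIV. Z $ k $ j) < y $ Some j)}"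
proof -
  have "0 < Phi x y Z $ None $ None" if "\<forall>i j. 0 < Z $ i $ j" for Z
  proof -
    have "0 < (\<Sum>k\<in>UNIV. \<Sum>l\<in>UNIV. Z $ k $ l)"
      using that by (intro sum_pos) auto
    then show ?thesis using assms by (simp add: Phi_corner)
  qed
  then show ?thesis by (auto simp: coord_domain_def)
qed

lemma eps_corner_redundant:
  fixes x y :: "real ^ ('n::finite) option" and C :: "real ^ ('n::finite) option ^ ('n::finite) option"
    and f :: "real \<Rightarrow> real" and \<gamma> :: real
  assumes "x \<in> prob_simplex" "y \<in> prob_simplex" "1 \<le> x $ None + y $ None"
    and "\<forall>i j. 0 < Z $ i $ j"
  defines "D \<equiv> rgrad f \<gamma> C x y Z"
  shows "eps f \<gamma> C x y Z =
     Min (range (eps_row x Z D) \<union> range (eps_col y Z D) \<union> range (\<lambda>(i, j). eps_entry Z D i j))"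
proof -
  let ?S = "range (eps_row x Z D) \<union> range (eps_col y Z D) \<union> range (\<lambda>(i, j). eps_entry Z D i j)"
  let ?d = "\<Sum>k\<in>UNIV. \<Sum>l\<in>UNIV. D $ k $ l"
  have fin: "finite ?S" and ne: "?S \<noteq> {}" by auto
  have le: "Min ?S \<le> eps_entry Z D i j" for i j
    by (rule Min_le[OF fin]) force
  have "Min ?S \<le> eps_corner x y Z D"
  proof (cases "?d > 0")
    case False
    have "\<exists>i j. D $ i $ j \<le> 0"
    proof (rule ccontr)
      assume "\<nexists>i j. D $ i $ j \<le> 0"
      then have "0 < ?d" by (intro sum_pos) (auto simp: not_le)
      with False show False by simp
    qed
    then obtain i j where "D $ i $ j \<le> 0" by blast
    with le[of i j] have "Min ?S \<le> 1" by (simp add: eps_entry_def)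
    then show ?thesis using False by (simp add: eps_corner_def)
  next
    case True
    have key: "2 * D $ i $ j * Min ?S \<le> Z $ i $ j" if "0 \<le> Min ?S" for i j
    proof (cases "D $ i $ j > 0")
      case True
      then show ?thesis using le[of i j] by (simp add: eps_entry_def field_simps)
    next
      case False
      then have "D $ i $ j * Min ?S \<le> 0" using that by (simp add: mult_nonpos_nonneg)
      then show ?thesis using assms(4)[rule_format, of i j] by linarith
    qed
    then have "2 * ?d * Min ?S \<le> Phi x y Z $ None $ None" if "0 \<le> Min ?S"
    proof -
      have "2 * ?d * Min ?S = (\<Sum>i\<in>UNIV. \<Sum>j\<in>UNIV. 2 * D $ i $ j * Min ?S)"
        by (simp add: sum_distrib_left sum_distrib_right)
      also have "\<dots> \<le> (\<Sum>i\<in>UNIV. \<Sum>j\<in>UNIV. Z $ i $ j)"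
        using key that by (intro sum_mono) blast
      also have "\<dots> \<le> Phi x y Z $ None $ None"
        using assms by (simp add: Phi_corner)
      finally show ?thesis .
    qed
    moreover have "0 \<le> Phi x y Z $ None $ None"
    proof -
      have "0 \<le> (\<Sum>k\<in>UNIV. \<Sum>l\<in>UNIV. Z $ k $ l)"
        using assms(4) by (intro sum_nonneg) (auto simp: less_imp_le)
      then show ?thesis using assms by (simp add: Phi_corner)
    qed
    moreover have "2 * ?d * Min ?S \<le> 0" if "\<not> 0 \<le> Min ?S"
      using that True by (intro mult_nonneg_nonpos) linarith+
    ultimately have "2 * ?d * Min ?S \<le> Phi x y Z $ None $ None"
      by linarith
    then show ?thesis using True by (simp add: eps_corner_def field_simps)
  qed
  moreover have "eps f \<gamma> C x y Z = Min (insert (eps_corner x y Z D) ?S)"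
    by (simp add: eps_def D_def Let_def)
  ultimately show ?thesis
    using Min_insert[OF fin ne, of "eps_corner x y Z D"] by (metis min.absorb2)
qed

definition line_cost ::
  "(real \<Rightarrow> real) \<Rightarrow> real \<Rightarrow> real ^ 'n option ^ 'n option \<Rightarrow> real ^ 'n option \<Rightarrow> real ^ 'n option
     \<Rightarrow> real ^ 'n ^ 'n \<Rightarrow> real \<Rightarrow> real" where
  "line_cost f \<gamma> C x y Z t = cost f \<gamma> C x y (Phi x y (Z - t *\<^sub>R rgrad f \<gamma> C x y Z))"

text \<open>The maximum is written as a supremum; that it is attained is part of the theorem.\<close>

definition D2 ::
  "(real \<Rightarrow> real) \<Rightarrow> real \<Rightarrow> real ^ 'n option ^ 'n option \<Rightarrow> real ^ 'n option \<Rightarrow> real ^ 'n option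
     \<Rightarrow> real ^ 'n ^ 'n \<Rightarrow> real" where
  "D2 f \<gamma> C x y Z =
     (SUP t\<in>{0..eps f \<gamma> C x y Z}. deriv (deriv (line_cost f \<gamma> C x y Z)) t)"

definition step_size ::
  "(real \<Rightarrow> real) \<Rightarrow> real \<Rightarrow> real ^ 'n option ^ 'n option \<Rightarrow> real ^ 'n option \<Rightarrow> real ^ 'n option
     \<Rightarrow> real ^ 'n ^ 'n \<Rightarrow> real" where
  "step_size f \<gamma> C x y Z = min (sqlen f \<gamma> C x y Z / D2 f \<gamma> C x y Z) (eps f \<gamma> C x y Z)"

text \<open>The sequence is indexed from \<open>0\<close>: \<open>descent \<dots> n\<close> is the iterate \<open>Z\<^bsup>n+1\<^esup>\<close>.\<close>

primrec descent ::
  "(real \<Rightarrow> real) \<Rightarrow> real \<Rightarrow> real ^ 'n option ^ 'n option \<Rightarrow> real ^ 'n option \<Rightarrow> real ^ 'n option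
     \<Rightarrow> nat \<Rightarrow> real ^ 'n ^ 'n" where
  "descent f \<gamma> C x y 0 = inv_into (coord_domain x y) (Phi x y) (outer x y)"
| "descent f \<gamma> C x y (Suc n) =
     (let Z = descent f \<gamma> C x y n in
      if rgrad f \<gamma> C x y Z = 0 then Z
      else Z - step_size f \<gamma> C x y Z *\<^sub>R rgrad f \<gamma> C x y Z)"

end

theory Submission
  imports Defs
begin

text \<open>
  The argument takes place in the space of matrices. Write \<open>P = \<Phi>(Z)\<close> and let \<open>A\<close> be the matrix of the
  partial derivatives of the cost \<open>F\<close> at \<open>P\<close> with respect to all \<open>N\<^sup>2\<close> entries. The differential of
  \<open>\<Phi>\<close> sends the coordinate vector \<open>D(Z)\<close> to the double centering \<open>H\<close> of \<open>A\<close>, which is the orthogonal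
  projection of \<open>A\<close> onto the space \<open>T\<close> of matrices with vanishing row and column sums
  (\<open>dPhi_rgrad\<close>), and \<open>G(Z) = |H|\<^sup>2\<close> (\<open>sqlen_eq\<close>). A step is therefore \<open>P\<^sub>n\<^sub>+\<^sub>1 = P\<^sub>n - t\<^sub>n H\<^sub>n\<close>,
  and all step bounds together say that no entry of \<open>P\<^sub>n\<close> loses more than half of its value.

  The number \<open>D\<^sub>2\<close> vanishes only if \<open>H = 0\<close>, because \<open>f'\<close> is strictly increasing and hence \<open>f''\<close> cannot
  vanish along a whole interval (\<open>D2_eq_0_iff\<close>).

  Convergence rests on two inequalities. Taylor's formula and \<open>t\<^sub>n D\<^sub>2 \<le> G\<close> give
  \<open>F(P\<^sub>n\<^sub>+\<^sub>1) \<le> F(P\<^sub>n) - t\<^sub>n |H\<^sub>n|\<^sup>2 / 2\<close> (\<open>sufficient_decrease\<close>). Combined with convexity this yields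
  \<open>|P\<^sub>n\<^sub>+\<^sub>1 - R|\<^sup>2 \<le> |P\<^sub>n - R|\<^sup>2 - 2 t\<^sub>n (F(P\<^sub>n\<^sub>+\<^sub>1) - F(R))\<close> for every coupling \<open>R\<close>
  (\<open>dist_to_coupling\<close>). Let \<open>R\<close> be the minimizer and suppose that \<open>F(P\<^sub>n)\<close> stays away from \<open>F(R)\<close>.
  Then \<open>\<Sum> t\<^sub>n\<close> and \<open>\<Sum> t\<^sub>n |H\<^sub>n|\<^sup>2\<close> are finite, so \<open>\<Sum> t\<^sub>n |H\<^sub>n|\<close> is finite and \<open>P\<^sub>n\<close> converges to
  some coupling \<open>Q\<close> (\<open>summable_step\<close>). Both possible kinds of limit are absurd:

  \<^item> If some entries of \<open>Q\<close> vanish, there is a direction \<open>V\<close> in \<open>T\<close> that is positive at these entries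
    and makes no obtuse angle with any \<open>P - Q\<close>, \<open>P\<close> a coupling (\<open>inward_normal_exists\<close>). The numbers
    \<open>V \<bullet> (P\<^sub>n - Q)\<close> are then nonnegative, tend to \<open>0\<close>, and eventually increase strictly, as
    \<open>f'(0) = -\<infinity>\<close> makes \<open>A\<^sub>n \<bullet> V\<close> tend to \<open>-\<infinity>\<close> (\<open>limit_in_pos_couplings\<close>).
  \<^item> If all entries of \<open>Q\<close> are positive, the steps \<open>t\<^sub>n\<close> are bounded away from \<open>0\<close>
    (\<open>step_bounded_below\<close>), which contradicts the finiteness of \<open>\<Sum> t\<^sub>n\<close>.

  Hence \<open>F(P\<^sub>n)\<close> tends to the minimum, and compactness of the set of couplings together with the
  uniqueness of the minimizer gives convergence of \<open>P\<^sub>n\<close> itself.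
\<close>

section \<open>One-variable analysis and series\<close>

lemma strictly_convex_on_imp_convex_on:
  assumes "strictly_convex_on S f"
  shows "convex_on S f"
proof -
  have *: "convex S" using assms by (simp add: strictly_convex_on_def)
  show ?thesis
  proof (rule convex_onI[OF _ *])
    fix t u v :: real
    assume t: "0 < t" "t < 1" and uv: "u \<in> S" "v \<in> S"
    show "f ((1 - t) *\<^sub>R u + t *\<^sub>R v) \<le> (1 - t) * f u + t * f v"
    proof (cases "u = v")
      case True
      then show ?thesis by (simp add: algebra_simps)
    next
      case False
      then have "f ((1 - t) * u + t * v) < (1 - t) * f u + t * f v"
        using assms t uv unfolding strictly_convex_on_def by blast
      then show ?thesis by simp
    qed
  qed
qed

text \<open>
  The weak inequality is the tangent inequality for convex functions. Applied at the midpoint of \<open>u\<close>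
  and \<open>v\<close>, where \<open>f\<close> lies strictly below its chord, it becomes strict at \<open>v\<close>.
\<close>

lemma strictly_convex_on_above_tangent:
  assumes "strictly_convex_on S f" "u \<in> interior S" "v \<in> S" "v \<noteq> u"
    and "(f has_real_derivative d) (at u)"
  shows "f u + d * (v - u) < f v"
proof -
  let ?m = "(1 - 1/2) * u + 1/2 * v"
  have uS: "u \<in> S" using assms(2) interior_subset by blast
  have conv: "convex S" using assms(1) by (simp add: strictly_convex_on_def)
  have mS: "?m \<in> S"
    using conv uS assms(3) unfolding convex_alt
    by (metis (no_types, lifting) real_scaleR_def divide_le_eq_1_pos half_gt_zero_iff less_eq_real_def
        one_le_numeral zero_less_numeral zero_less_one)
  have *: "d * (w - u) \<le> f w - f u" if "w \<in> S" for w
  proof (rule convex_on_imp_above_tangent[OF strictly_convex_on_imp_convex_on[OF assms(1)]])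
    show "connected S" using conv by (rule convex_connected)
    show "(f has_real_derivative d) (at u within S)"
      using assms(5) by (rule has_field_derivative_at_within)
  qed (use assms that in auto)
  have "f ((1 - t) * u + t * v) < (1 - t) * f u + t * f v" if "0 < t" "t < 1" for t
    using assms(1,3,4) uS that unfolding strictly_convex_on_def by auto
  from this[of "1/2"] have "f ?m < (1 - 1/2) * f u + 1/2 * f v"
    by simp
  moreover have "d * ((v - u) / 2) \<le> f ?m - f u"
    using *[OF mS] by (simp add: field_simps)
  ultimately show ?thesis by (simp add: field_simps)
qed

lemma second_order_upper_bound:
  fixes \<phi> \<phi>' \<phi>'' :: "real \<Rightarrow> real"
  assumes "\<And>s. s \<in> {0..t} \<Longrightarrow> (\<phi> has_real_derivative \<phi>' s) (at s)"
    and "\<And>s. s \<in> {0..t} \<Longrightarrow> (\<phi>' has_real_derivative \<phi>'' s) (at s)"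
    and "\<And>s. s \<in> {0..t} \<Longrightarrow> \<phi>'' s \<le> M" and "0 \<le> t"
  shows "\<phi> t \<le> \<phi> 0 + t * \<phi>' 0 + M * t\<^sup>2 / 2"
proof -
  have 1: "\<phi>' s \<le> \<phi>' 0 + M * s" if s: "s \<in> {0..t}" for s
  proof -
    have "(\<lambda>r. M * r - \<phi>' r) 0 \<le> (\<lambda>r. M * r - \<phi>' r) s"
    proof (rule DERIV_nonneg_imp_nondecreasing[where f = "\<lambda>r. M * r - \<phi>' r"])
      show "0 \<le> s" using s by simp
      fix r assume "0 \<le> r" "r \<le> s"
      then have r: "r \<in> {0..t}" using s by simp
      have "((\<lambda>r. M * r - \<phi>' r) has_real_derivative M - \<phi>'' r) (at r)"
        using assms(2)[OF r] by (auto intro!: derivative_eq_intros)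
      then show "\<exists>d. ((\<lambda>r. M * r - \<phi>' r) has_real_derivative d) (at r) \<and> 0 \<le> d"
        using assms(3)[OF r] by auto
    qed
    then show ?thesis by simp
  qed
  have "(\<lambda>r. \<phi>' 0 * r + M * r\<^sup>2 / 2 - \<phi> r) 0 \<le> (\<lambda>r. \<phi>' 0 * r + M * r\<^sup>2 / 2 - \<phi> r) t"
  proof (rule DERIV_nonneg_imp_nondecreasing[where f = "\<lambda>r. \<phi>' 0 * r + M * r\<^sup>2 / 2 - \<phi> r"])
    fix r assume "0 \<le> r" "r \<le> t"
    then have r: "r \<in> {0..t}" by simp
    have "((\<lambda>r. \<phi>' 0 * r + M * r\<^sup>2 / 2 - \<phi> r) has_real_derivative \<phi>' 0 + M * r - \<phi>' r) (at r)"
      using assms(1)[OF r] by (auto intro!: derivative_eq_intros)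
    then show "\<exists>d. ((\<lambda>r. \<phi>' 0 * r + M * r\<^sup>2 / 2 - \<phi> r) has_real_derivative d) (at r) \<and> 0 \<le> d"
      using 1[OF r] by auto
  qed (rule assms(4))
  then show ?thesis by (simp add: algebra_simps)
qed

lemma summable_if_le_decrease:
  fixes a u :: "nat \<Rightarrow> real"
  assumes "\<And>n. 0 \<le> a n" "\<And>n. a n \<le> u n - u (Suc n)" "\<And>n. c \<le> u n"
  shows "summable a"
proof (rule summableI_nonneg_bounded[OF assms(1)])
  fix n
  have "sum a {..<n} \<le> u 0 - u n"
  proof (induction n)
    case (Suc n)
    then show ?case using assms(2)[of n] by simp
  qed simp
  then show "sum a {..<n} \<le> u 0 - c" using assms(3)[of n] by linarith
qed

lemma convergent_if_summable_increments:
  fixes P :: "nat \<Rightarrow> 'a::banach"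
  assumes "summable (\<lambda>n. norm (P (Suc n) - P n))"
  shows "convergent P"
proof -
  have "summable (\<lambda>n. P (Suc n) - P n)"
    using assms by (rule summable_norm_cancel)
  then have "convergent (\<lambda>n. (\<Sum>k<n. P (Suc k) - P k) + P 0)"
    by (intro convergent_add convergent_const) (simp add: summable_iff_convergent)
  then show ?thesis by (simp add: sum_lessThan_telescope)
qed

lemma filterlim_sum_at_top:
  fixes g :: "'i \<Rightarrow> 'a \<Rightarrow> real"
  assumes "finite S" "S \<noteq> {}" "\<And>i. i \<in> S \<Longrightarrow> filterlim (g i) at_top \<F>"
  shows "filterlim (\<lambda>a. \<Sum>i\<in>S. g i a) at_top \<F>"
  using assms
  by (induction S rule: finite_ne_induct) (auto intro: filterlim_at_top_add_at_top)

section \<open>Couplings in coordinates\<close>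

lemma sum_UNIV_option:
  fixes g :: "'n::finite option \<Rightarrow> 'a::comm_monoid_add"
  shows "(\<Sum>i\<in>UNIV. g i) = g None + (\<Sum>k\<in>UNIV. g (Some k))"
  by (simp add: UNIV_option_conv sum.reindex)

lemma inner_matrix:
  fixes P Q :: "real ^ 'm ^ 'n"
  shows "P \<bullet> Q = (\<Sum>i\<in>UNIV. \<Sum>j\<in>UNIV. P $ i $ j * Q $ i $ j)"
  by (simp add: inner_vec_def)

definition tangent :: "(real ^ 'm ^ 'm) set" where
  "tangent = {V. (\<forall>i. (\<Sum>k\<in>UNIV. V $ i $ k) = 0) \<and> (\<forall>j. (\<Sum>k\<in>UNIV. V $ k $ j) = 0)}"

text \<open>The differential of \<open>Phi x y\<close>, which does not depend on the base point.\<close>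

definition dPhi :: "real ^ 'n ^ 'n \<Rightarrow> real ^ 'n option ^ 'n option" where
  "dPhi W = (\<chi> i j. case i of
      Some i' \<Rightarrow> (case j of Some j' \<Rightarrow> W $ i' $ j' | None \<Rightarrow> - (\<Sum>k\<in>UNIV. W $ i' $ k))
    | None \<Rightarrow> (case j of Some j' \<Rightarrow> - (\<Sum>k\<in>UNIV. W $ k $ j')
        | None \<Rightarrow> (\<Sum>k\<in>UNIV. \<Sum>l\<in>UNIV. W $ k $ l)))"

definition chart :: "real ^ 'n option ^ 'n option \<Rightarrow> real ^ 'n ^ 'n" where
  "chart P = (\<chi> i j. P $ Some i $ Some j)"

lemma Phi_nth [simp]:
  "Phi x y Z $ Some i $ Some j = Z $ i $ j"
  "Phi x y Z $ Some i $ None = x $ Some i - (\<Sum>k\<in>UNIV. Z $ i $ k)"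
  "Phi x y Z $ None $ Some j = y $ Some j - (\<Sum>k\<in>UNIV. Z $ k $ j)"
  by (simp_all add: Phi_def)

lemma dPhi_nth [simp]:
  "dPhi W $ Some i $ Some j = W $ i $ j"
  "dPhi W $ Some i $ None = - (\<Sum>k\<in>UNIV. W $ i $ k)"
  "dPhi W $ None $ Some j = - (\<Sum>k\<in>UNIV. W $ k $ j)"
  "dPhi W $ None $ None = (\<Sum>k\<in>UNIV. \<Sum>l\<in>UNIV. W $ k $ l)"
  by (simp_all add: dPhi_def)

lemma chart_nth [simp]: "chart P $ i $ j = P $ Some i $ Some j"
  by (simp add: chart_def)

lemma matrix_option_eqI:
  fixes P Q :: "real ^ ('n::finite) option ^ 'n option"
  assumes "\<And>i j. P $ Some i $ Some j = Q $ Some i $ Some j"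
    and "\<And>i. P $ Some i $ None = Q $ Some i $ None"
    and "\<And>j. P $ None $ Some j = Q $ None $ Some j"
    and "P $ None $ None = Q $ None $ None"
  shows "P = Q"
proof -
  have "P $ i $ j = Q $ i $ j" for i j
    using assms by (cases i; cases j) auto
  then show ?thesis by (simp add: vec_eq_iff)
qed

lemma Phi_add_scaleR:
  fixes Z W :: "real ^ ('n::finite) ^ 'n"
  shows "Phi x y (Z + s *\<^sub>R W) = Phi x y Z + s *\<^sub>R dPhi W"
  by (rule matrix_option_eqI)
     (simp_all add: Phi_def sum.distrib sum_distrib_left algebra_simps)

lemma Phi_diff_scaleR:
  fixes Z W :: "real ^ ('n::finite) ^ 'n"
  shows "Phi x y (Z - s *\<^sub>R W) = Phi x y Z - s *\<^sub>R dPhi W"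
  using Phi_add_scaleR[of x y Z "-s" W] by simp

lemma chart_Phi [simp]: "chart (Phi x y Z) = Z"
  by (simp add: vec_eq_iff)

lemma dPhi_chart:
  fixes V :: "real ^ ('n::finite) option ^ 'n option"
  assumes "V \<in> tangent"
  shows "dPhi (chart V) = V"
proof -
  have row: "V $ i $ None = - (\<Sum>k\<in>UNIV. V $ i $ Some k)"
    and col: "V $ None $ i = - (\<Sum>k\<in>UNIV. V $ Some k $ i)" for i
    using assms by (auto simp: tangent_def sum_UNIV_option add_eq_0_iff2)
  show ?thesis
    using sum.swap[of "\<lambda>k l. V $ Some k $ Some l" UNIV UNIV]
    by (intro matrix_option_eqI) (simp_all add: row col sum_negf)
qed

lemma Phi_chart:
  fixes P :: "real ^ ('n::finite) option ^ 'n option"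
  assumes "x \<in> prob_simplex" "y \<in> prob_simplex" "P \<in> couplings x y"
  shows "Phi x y (chart P) = P"
proof -
  have row: "P $ i $ None = x $ i - (\<Sum>k\<in>UNIV. P $ i $ Some k)" for i
    using assms(3) by (auto simp: couplings_def sum_UNIV_option eq_diff_eq)
  have col: "P $ None $ j = y $ j - (\<Sum>k\<in>UNIV. P $ Some k $ j)" for j
    using assms(3) by (auto simp: couplings_def sum_UNIV_option eq_diff_eq)
  have "(\<Sum>k\<in>UNIV. x $ Some k) = 1 - x $ None"
    using assms(1) by (simp add: prob_simplex_def sum_UNIV_option)
  then have "(\<Sum>k\<in>UNIV. P $ Some k $ None) = 1 - x $ None - (\<Sum>k\<in>UNIV. \<Sum>l\<in>UNIV. P $ Some k $ Some l)"
    by (simp add: row sum_subtractf)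
  then have "P $ None $ None = x $ None + y $ None - 1 + (\<Sum>k\<in>UNIV. \<Sum>l\<in>UNIV. P $ Some k $ Some l)"
    using col[of None] by simp
  then show ?thesis
    by (intro matrix_option_eqI) (simp_all add: row col Phi_corner[OF assms(1,2)])
qed

lemma Phi_sums:
  fixes Z :: "real ^ ('n::finite) ^ 'n"
  assumes "x \<in> prob_simplex" "y \<in> prob_simplex"
  shows "(\<Sum>k\<in>UNIV. Phi x y Z $ i $ k) = x $ i" "(\<Sum>k\<in>UNIV. Phi x y Z $ k $ j) = y $ j"
proof -
  have xs: "(\<Sum>k\<in>UNIV. x $ Some k) = 1 - x $ None" "(\<Sum>k\<in>UNIV. y $ Some k) = 1 - y $ None"
    using assms by (simp_all add: prob_simplex_def sum_UNIV_option)
  show "(\<Sum>k\<in>UNIV. Phi x y Z $ i $ k) = x $ i"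
    using xs sum.swap[of "\<lambda>k l. Z $ k $ l" UNIV UNIV]
    by (cases i) (simp_all add: sum_UNIV_option Phi_corner[OF assms] sum_subtractf)
  show "(\<Sum>k\<in>UNIV. Phi x y Z $ k $ j) = y $ j"
    using xs sum.swap[of "\<lambda>k l. Z $ k $ l" UNIV UNIV]
    by (cases j) (simp_all add: sum_UNIV_option Phi_corner[OF assms] sum_subtractf)
qed

lemma coupling_entry_le:
  assumes "P \<in> couplings x y"
  shows "P $ i $ j \<le> x $ i"
proof -
  have "P $ i $ j \<le> (\<Sum>k\<in>UNIV. P $ i $ k)"
    using assms by (intro member_le_sum) (auto simp: couplings_def)
  then show ?thesis using assms by (simp add: couplings_def)
qed

lemma prob_simplex_entry_less_1:
  fixes x :: "real ^ ('n::finite) option"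
  assumes "x \<in> prob_simplex" "\<And>i. 0 < x $ i"
  shows "x $ i < 1"
proof -
  \<comment> \<open>There are at least two indices, so another positive entry takes part in the sum.\<close>
  obtain j where "j \<noteq> i" by (metis option.distinct(1))
  then have "x $ i + x $ j = (\<Sum>k\<in>{i, j}. x $ k)" by simp
  also have "\<dots> \<le> (\<Sum>k\<in>UNIV. x $ k)"
    using assms(2) by (intro sum_mono2) (auto intro: less_imp_le)
  finally show ?thesis using assms by (simp add: prob_simplex_def) (metis add_le_same_cancel1 less_add_same_cancel1 order_less_le_trans assms(2))
qed

lemma coord_domain_iff:
  fixes x y :: "real ^ ('n::finite) option"
  assumes "x \<in> prob_simplex" "y \<in> prob_simplex" "\<And>i. 0 < x $ i"
  shows "Z \<in> coord_domain x y \<longleftrightarrow> (\<forall>i j. 0 < Phi x y Z $ i $ j)"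
proof
  assume Z: "Z \<in> coord_domain x y"
  have "0 < Phi x y Z $ i $ j" for i j
    using Z by (cases i; cases j) (auto simp: coord_domain_def)
  then show "\<forall>i j. 0 < Phi x y Z $ i $ j" by blast
next
  assume *: "\<forall>i j. 0 < Phi x y Z $ i $ j"
  then have P: "Phi x y Z \<in> couplings x y"
    using assms by (auto simp: couplings_def Phi_sums less_imp_le)
  have 1: "Z $ i $ j < 1" for i j
    using coupling_entry_le[OF P, of "Some i" "Some j"]
      prob_simplex_entry_less_1[OF assms(1,3), of "Some i"] by simp
  show "Z \<in> coord_domain x y"
    unfolding coord_domain_def
  proof (intro CollectI conjI allI)
    fix i j
    show "0 < Z $ i $ j" using *[rule_format, of "Some i" "Some j"] by simp
    show "Z $ i $ j < 1" by (rule 1)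
    show "(\<Sum>k\<in>UNIV. Z $ i $ k) < x $ Some i" using *[rule_format, of "Some i" "None"] by simp
    show "(\<Sum>k\<in>UNIV. Z $ k $ j) < y $ Some j" using *[rule_format, of "None" "Some j"] by simp
    show "0 < Phi x y Z $ None $ None" using * by blast
  qed
qed

text \<open>
  Double centering is the orthogonal projection onto \<open>tangent\<close>: see \<open>center_tangent\<close> and
  \<open>inner_center\<close>.
\<close>

definition center :: "real ^ 'm ^ 'm \<Rightarrow> real ^ 'm ^ 'm" where
  "center A = (\<chi> i j. A $ i $ j - (\<Sum>l\<in>UNIV. A $ i $ l) / real CARD('m)
     - (\<Sum>k\<in>UNIV. A $ k $ j) / real CARD('m)
     + (\<Sum>k\<in>UNIV. \<Sum>l\<in>UNIV. A $ k $ l) / (real CARD('m))\<^sup>2)"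

lemma center_tangent: "center A \<in> tangent"
proof -
  have sw: "(\<Sum>k\<in>UNIV. \<Sum>l\<in>UNIV. A $ l $ k) = (\<Sum>k\<in>UNIV. \<Sum>l\<in>UNIV. A $ k $ l)"
    by (rule sum.swap)
  show ?thesis
    by (auto simp: tangent_def center_def sum.distrib sum_subtractf sw
        simp flip: sum_divide_distrib simp: power2_eq_square)
qed

lemma inner_center:
  assumes "V \<in> tangent"
  shows "center A \<bullet> V = A \<bullet> V"
proof -
  have row: "(\<Sum>j\<in>UNIV. V $ i $ j) = 0" and col: "(\<Sum>i\<in>UNIV. V $ i $ j) = 0" for i j
    using assms by (auto simp: tangent_def)
  have 1: "(\<Sum>i\<in>UNIV. \<Sum>j\<in>UNIV. a i * V $ i $ j) = 0" for a
    by (simp add: row flip: sum_distrib_left)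
  have 2: "(\<Sum>i\<in>UNIV. \<Sum>j\<in>UNIV. a j * V $ i $ j) = 0" for a
    by (subst sum.swap) (simp add: col flip: sum_distrib_left)
  show ?thesis
    using 1[of "\<lambda>i. (\<Sum>l\<in>UNIV. A $ i $ l) / real CARD('a)"]
      2[of "\<lambda>j. (\<Sum>k\<in>UNIV. A $ k $ j) / real CARD('a)"]
      1[of "\<lambda>_. (\<Sum>k\<in>UNIV. \<Sum>l\<in>UNIV. A $ k $ l) / (real CARD('a))\<^sup>2"]
    by (simp add: inner_matrix center_def ring_distribs sum.distrib sum_subtractf)
qed

text \<open>
  The inverse metric is a tensor product, so contracting with it reduces to one index. In one index,
  only differences \<open>b (Some k) - b None\<close> occur in coordinates, and the contraction is centering up to sign.
\<close>

lemma sum_inv_metric_factor: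
  fixes b :: "'n::finite option \<Rightarrow> real"
  shows "(\<Sum>k\<in>UNIV. (1 / real CARD('n option) - kdelta i k) * (b (Some k) - b None))
    = (\<Sum>k\<in>UNIV. b k) / real CARD('n option) - b (Some i)"
proof -
  have *: "(\<Sum>k\<in>UNIV. kdelta i k * c k) = c i" for c :: "'n \<Rightarrow> real"
    by (simp add: kdelta_def if_distrib[of "\<lambda>z. z * _"] cong: if_cong)
  have "(\<Sum>k\<in>UNIV. (1 / real CARD('n option) - kdelta i k) * (b (Some k) - b None))
    = (\<Sum>k\<in>UNIV. (b (Some k) - b None)) / real CARD('n option) - (b (Some i) - b None)"
    unfolding left_diff_distrib sum_subtractf[of "\<lambda>k. _ * (_ k)"] *[of "\<lambda>k. b (Some k) - b None"]
    by (simp flip: sum_divide_distrib)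
  moreover have "(\<Sum>k\<in>UNIV. (b (Some k) - b None)) = (\<Sum>k\<in>UNIV. b k) - real CARD('n option) * b None"
    by (simp add: sum_UNIV_option sum_subtractf algebra_simps)
  ultimately show ?thesis
    by (simp add: diff_divide_distrib)
qed

text \<open>
  The matrix in parentheses is the coordinate gradient of a function with ambient gradient \<open>A\<close>. The
  factorization of the inverse metric applies \<open>sum_inv_metric_factor\<close> once to the columns and once to
  the rows; the two signs cancel.
\<close>

lemma inv_metric_contraction:
  fixes A :: "real ^ ('n::finite) option ^ 'n option"
  shows "(\<Sum>k\<in>UNIV. \<Sum>l\<in>UNIV. inv_metric i j k l *
      (A $ Some k $ Some l - A $ Some k $ None - A $ None $ Some l + A $ None $ None))
    = center A $ Some i $ Some j"
proof -
  define N where "N = real CARD('n option)"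
  define b where "b k = (\<Sum>l\<in>UNIV. A $ k $ l) / N - A $ k $ Some j" for k
  have "(\<Sum>l\<in>UNIV. inv_metric i j k l *
      (A $ Some k $ Some l - A $ Some k $ None - A $ None $ Some l + A $ None $ None))
    = (1 / N - kdelta i k) * (b (Some k) - b None)" for k
  proof -
    have "(\<Sum>l\<in>UNIV. inv_metric i j k l *
      (A $ Some k $ Some l - A $ Some k $ None - A $ None $ Some l + A $ None $ None))
      = (1 / N - kdelta i k) * (\<Sum>l\<in>UNIV. (1 / N - kdelta j l) *
         ((A $ Some k $ Some l - A $ None $ Some l) - (A $ Some k $ None - A $ None $ None)))"
      unfolding inv_metric_def sum_distrib_left N_def[symmetric]
      by (intro sum.cong refl) (simp add: diff_diff_eq2 add.commute diff_add_eq mult.assoc)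
    also have "\<dots> = (1 / N - kdelta i k) * (b (Some k) - b None)"
      unfolding N_def
      by (subst sum_inv_metric_factor[of j "\<lambda>l. A $ Some k $ l - A $ None $ l"])
         (simp add: b_def N_def sum_subtractf diff_divide_distrib)
    finally show ?thesis .
  qed
  then have "(\<Sum>k\<in>UNIV. \<Sum>l\<in>UNIV. inv_metric i j k l *
      (A $ Some k $ Some l - A $ Some k $ None - A $ None $ Some l + A $ None $ None))
    = (\<Sum>k\<in>UNIV. (1 / N - kdelta i k) * (b (Some k) - b None))"
    by (simp only:)
  also have "\<dots> = (\<Sum>k\<in>UNIV. b k) / N - b (Some i)"
    unfolding N_def by (rule sum_inv_metric_factor)
  also have "\<dots> = center A $ Some i $ Some j"
    unfolding center_def N_def[symmetric] b_def
    by (simp add: sum_subtractf diff_divide_distrib power2_eq_square flip: sum_divide_distrib)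
  finally show ?thesis .
qed

text \<open>
  The metric is the Frobenius inner product pulled back along \<open>\<Phi>\<close>. The four terms of
  \<open>(1 + \<delta>\<^sub>i\<^sub>k) (1 + \<delta>\<^sub>j\<^sub>l)\<close> account for the corner, the last row, the last column and the remaining entries
  of \<open>dPhi d\<close>.
\<close>

lemma metric_contraction:
  fixes d :: "real ^ ('n::finite) ^ 'n"
  shows "(\<Sum>i\<in>UNIV. \<Sum>j\<in>UNIV. \<Sum>k\<in>UNIV. \<Sum>l\<in>UNIV. metric i j k l * d $ i $ j * d $ k $ l)
    = dPhi d \<bullet> dPhi d"
proof -
  let ?row = "\<lambda>i. \<Sum>l\<in>UNIV. d $ i $ l" and ?col = "\<lambda>j. \<Sum>k\<in>UNIV. d $ k $ j"
  let ?tot = "\<Sum>k\<in>UNIV. \<Sum>l\<in>UNIV. d $ k $ l"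
  have k: "(\<Sum>k\<in>UNIV. (1 + kdelta i k) * c k) = (\<Sum>k\<in>UNIV. c k) + c i" for i :: 'n and c
    by (simp add: ring_distribs sum.distrib kdelta_def if_distrib[of "\<lambda>z. z * _"] cong: if_cong)
  have inn: "(\<Sum>k\<in>UNIV. \<Sum>l\<in>UNIV. metric i j k l * d $ i $ j * d $ k $ l)
    = d $ i $ j * (?tot + ?col j + ?row i + d $ i $ j)" for i j
  proof -
    have "(\<Sum>k\<in>UNIV. \<Sum>l\<in>UNIV. metric i j k l * d $ i $ j * d $ k $ l)
      = d $ i $ j * (\<Sum>k\<in>UNIV. (1 + kdelta i k) * (\<Sum>l\<in>UNIV. (1 + kdelta j l) * d $ k $ l))"
      unfolding metric_def sum_distrib_left by (simp add: mult_ac)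
    then show ?thesis by (simp add: k sum.distrib)
  qed
  have sw: "(\<Sum>j\<in>UNIV. \<Sum>i\<in>UNIV. d $ i $ j * c j) = (\<Sum>i\<in>UNIV. \<Sum>j\<in>UNIV. d $ i $ j * c j)" for c
    by (rule sum.swap)
  show ?thesis
    unfolding inn inner_matrix
    by (simp add: sum_UNIV_option sum.distrib ring_distribs sum_distrib_right[symmetric]
        sum_distrib_left[symmetric] sum_negf)
       (simp add: sum_distrib_right sw)
qed

section \<open>Regularized transport cost\<close>

text \<open>
  The derivatives \<open>f'\<close> and \<open>f''\<close> are parameters because the second derivative is only given by an
  existence statement. They are one-sided at \<open>1\<close>, so that both are continuous on the compact intervals
  \<open>[\<delta>, 1]\<close>.
\<close>

locale regularized_transport =
  fixes f f' f'' :: "real \<Rightarrow> real" and \<gamma> :: real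
    and C :: "real ^ ('n::finite) option ^ 'n option" and x y :: "real ^ 'n option"
  assumes strictly_convex: "strictly_convex_on {0..1} f"
    and continuous: "continuous_on {0..1} f"
    and deriv_within: "\<And>u. u \<in> {0<..1} \<Longrightarrow> (f has_real_derivative f' u) (at u within {0<..1})"
    and deriv2_within: "\<And>u. u \<in> {0<..1} \<Longrightarrow> (f' has_real_derivative f'' u) (at u within {0<..1})"
    and continuous_deriv2: "continuous_on {0<..1} f''"
    and deriv_at_0: "filterlim f' at_bot (at_right 0)"
    and gamma_pos: "0 < \<gamma>"
    and x_simplex: "x \<in> prob_simplex" and y_simplex: "y \<in> prob_simplex"
    and x_pos: "\<And>i. 0 < x $ i" and y_pos: "\<And>j. 0 < y $ j"
begin

lemma at_within_unit:
  fixes u :: real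
  assumes "0 < u" "u < 1"
  shows "at u within {0<..1} = at u"
  using assms by (intro at_within_open_subset[of u "{0<..<1}"]) auto

lemma deriv_f: "0 < u \<Longrightarrow> u < 1 \<Longrightarrow> (f has_real_derivative f' u) (at u)"
  using deriv_within[of u] by (simp add: at_within_unit)

lemma deriv_f': "0 < u \<Longrightarrow> u < 1 \<Longrightarrow> (f' has_real_derivative f'' u) (at u)"
  using deriv2_within[of u] by (simp add: at_within_unit)

lemma above_tangent:
  assumes "0 < u" "u < 1" "v \<in> {0..1}" "v \<noteq> u"
  shows "f u + f' u * (v - u) < f v"
  using assms by (intro strictly_convex_on_above_tangent[OF strictly_convex] deriv_f) auto

lemma f'_strict_mono:
  assumes "0 < u" "u < v" "v < 1"
  shows "f' u < f' v"
proof -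
  have "f u + f' u * (v - u) < f v" "f v + f' v * (u - v) < f u"
    using assms by (auto intro!: above_tangent)
  then have "0 < (f' v - f' u) * (v - u)" by (simp add: algebra_simps)
  then show ?thesis using assms by (simp add: zero_less_mult_iff)
qed

lemma f''_nonneg:
  assumes "0 < u" "u < 1"
  shows "0 \<le> f'' u"
proof (rule ccontr)
  assume "\<not> 0 \<le> f'' u"
  then obtain d where d: "d > 0" "\<And>h. 0 < h \<Longrightarrow> h < d \<Longrightarrow> f' (u + h) < f' u"
    using DERIV_neg_dec_right[OF deriv_f'[OF assms]] by auto
  define h where "h = min (d / 2) ((1 - u) / 2)"
  have "0 < h" "h < d" "u + h < 1" using d(1) assms by (auto simp: h_def min_def field_simps)
  then show False using d(2)[of h] f'_strict_mono[of u "u + h"] assms by simp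
qed

abbreviation F where "F \<equiv> cost f \<gamma> C x y"

text \<open>
  The gradient of the cost with respect to all entries, before restriction to the tangent space.
\<close>

definition grad :: "real ^ 'n option ^ 'n option \<Rightarrow> real ^ 'n option ^ 'n option" where
  "grad P = (\<chi> i j. C $ i $ j + \<gamma> * (f' (P $ i $ j) - deriv01 f (x $ i * y $ j)))"

text \<open>
  The second derivative of the cost at \<open>P\<close> in the direction \<open>V\<close>.
\<close>

definition hess :: "real ^ 'n option ^ 'n option \<Rightarrow> real ^ 'n option ^ 'n option \<Rightarrow> real" where
  "hess P V = \<gamma> * (\<Sum>i\<in>UNIV. \<Sum>j\<in>UNIV. f'' (P $ i $ j) * (V $ i $ j)\<^sup>2)"

definition pos_couplings :: "(real ^ 'n option ^ 'n option) set" where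
  "pos_couplings = {P \<in> couplings x y. \<forall>i j. 0 < P $ i $ j}"

lemma F_sum: "F P = (\<Sum>i\<in>UNIV. \<Sum>j\<in>UNIV. C $ i $ j * P $ i $ j +
    \<gamma> * (f (P $ i $ j) - f (x $ i * y $ j) - deriv01 f (x $ i * y $ j) * (P $ i $ j - x $ i * y $ j)))"
  by (simp add: cost_def bregman_def outer_def sum.distrib sum_distrib_left)

lemma x_less_1: "x $ i < 1"
  by (rule prob_simplex_entry_less_1[OF x_simplex x_pos])

lemma coupling_entry_less_1: "P \<in> couplings x y \<Longrightarrow> P $ i $ j < 1"
  using coupling_entry_le[of P x y i j] x_less_1[of i] by linarith

lemma coupling_entry_unit: "P \<in> couplings x y \<Longrightarrow> P $ i $ j \<in> {0..1}"
  using coupling_entry_less_1[of P i j] by (simp add: couplings_def less_imp_le)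

lemma pos_couplingsD:
  assumes "P \<in> pos_couplings"
  shows "P \<in> couplings x y" "0 < P $ i $ j" "P $ i $ j < 1"
  using assms coupling_entry_less_1 by (auto simp: pos_couplings_def)

lemma Phi_in_pos_couplings: "Phi x y Z \<in> pos_couplings \<longleftrightarrow> Z \<in> coord_domain x y"
  by (auto simp: coord_domain_iff[OF x_simplex y_simplex x_pos] pos_couplings_def couplings_def
      Phi_sums[OF x_simplex y_simplex] less_imp_le)

lemma outer_pos_coupling: "outer x y \<in> pos_couplings"
proof -
  have "(\<Sum>k\<in>UNIV. x $ k) = 1" "(\<Sum>k\<in>UNIV. y $ k) = 1"
    using x_simplex y_simplex by (auto simp: prob_simplex_def)
  then show ?thesis
    using x_pos y_pos
    by (auto simp: pos_couplings_def couplings_def outer_def less_imp_le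
        simp flip: sum_distrib_left sum_distrib_right)
qed

lemma diff_couplings_tangent:
  "P \<in> couplings x y \<Longrightarrow> Q \<in> couplings x y \<Longrightarrow> P - Q \<in> tangent"
  by (auto simp: couplings_def tangent_def sum_subtractf)

lemma F_above_tangent:
  assumes "P \<in> pos_couplings" "Q \<in> couplings x y"
  shows "F P + grad P \<bullet> (Q - P) \<le> F Q"
proof -
  have *: "f (P $ i $ j) + f' (P $ i $ j) * (Q $ i $ j - P $ i $ j) \<le> f (Q $ i $ j)" for i j
    using above_tangent[OF pos_couplingsD(2,3)[OF assms(1)] coupling_entry_unit[OF assms(2)]]
    by (cases "Q $ i $ j = P $ i $ j") (auto intro: less_imp_le)
  show ?thesis
    unfolding F_sum inner_matrix sum.distrib[symmetric]
  proof (intro sum_mono)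
    fix i j
    show "C $ i $ j * P $ i $ j + \<gamma> * (f (P $ i $ j) - f (x $ i * y $ j)
          - deriv01 f (x $ i * y $ j) * (P $ i $ j - x $ i * y $ j))
        + grad P $ i $ j * (Q - P) $ i $ j
      \<le> C $ i $ j * Q $ i $ j + \<gamma> * (f (Q $ i $ j) - f (x $ i * y $ j)
          - deriv01 f (x $ i * y $ j) * (Q $ i $ j - x $ i * y $ j))"
      using mult_left_mono[OF *[of i j] less_imp_le[OF gamma_pos]]
      by (simp add: grad_def algebra_simps)
  qed
qed

lemma convex_couplings: "convex (couplings x y)"
  unfolding convex_def couplings_def
  by (auto simp: sum.distrib simp flip: sum_distrib_left distrib_right)

text \<open>
  Midpoints suffice for the uniqueness of the minimizer. Entries may vanish here, so the inequality
  comes from strict convexity of \<open>f\<close> on \<open>[0,1]\<close> instead of derivatives.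
\<close>

lemma F_strictly_convex:
  assumes "P \<in> couplings x y" "Q \<in> couplings x y" "P \<noteq> Q"
  shows "F ((1/2) *\<^sub>R P + (1/2) *\<^sub>R Q) < (F P + F Q) / 2"
proof -
  have strict: "f (u / 2 + v / 2) < (f u + f v) / 2" if "u \<in> {0..1}" "v \<in> {0..1}" "u \<noteq> v" for u v
  proof -
    have "f ((1 - t) * u + t * v) < (1 - t) * f u + t * f v" if "0 < t" "t < 1" for t
      using strictly_convex \<open>u \<in> {0..1}\<close> \<open>v \<in> {0..1}\<close> \<open>u \<noteq> v\<close> that
      unfolding strictly_convex_on_def by blast
    from this[of "1/2"] show ?thesis by (simp add: add_divide_distrib)
  qed
  define e where "e i j p = C $ i $ j * p + \<gamma> * (f p - f (x $ i * y $ j)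
      - deriv01 f (x $ i * y $ j) * (p - x $ i * y $ j))" for i j p
  have F: "F R = (\<Sum>i\<in>UNIV. \<Sum>j\<in>UNIV. e i j (R $ i $ j))" for R
    unfolding F_sum e_def ..
  have e_strict: "e i j (u / 2 + v / 2) < (e i j u + e i j v) / 2"
    if "u \<in> {0..1}" "v \<in> {0..1}" "u \<noteq> v" for u v i j
  proof -
    have "\<gamma> * f (u / 2 + v / 2) < \<gamma> * ((f u + f v) / 2)"
      using strict[OF that] gamma_pos by (rule mult_strict_left_mono)
    then show ?thesis by (simp add: e_def field_simps)
  qed
  have e_le: "e i j (u / 2 + v / 2) \<le> (e i j u + e i j v) / 2"
    if "u \<in> {0..1}" "v \<in> {0..1}" for u v i j
    using e_strict[OF that, of i j] by (cases "u = v") (auto intro: less_imp_le)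
  obtain a b where ab: "P $ a $ b \<noteq> Q $ a $ b"
    using assms(3) by (auto simp: vec_eq_iff)
  have unit: "P $ i $ j \<in> {0..1}" "Q $ i $ j \<in> {0..1}" for i j
    using assms coupling_entry_unit by blast+
  have "F ((1/2) *\<^sub>R P + (1/2) *\<^sub>R Q) = (\<Sum>i\<in>UNIV. \<Sum>j\<in>UNIV. e i j (P $ i $ j / 2 + Q $ i $ j / 2))"
    by (simp add: F)
  also have "\<dots> < (\<Sum>i\<in>UNIV. \<Sum>j\<in>UNIV. (e i j (P $ i $ j) + e i j (Q $ i $ j)) / 2)"
  proof (rule sum_strict_mono_ex1)
    show "\<forall>i\<in>UNIV. (\<Sum>j\<in>UNIV. e i j (P $ i $ j / 2 + Q $ i $ j / 2))
        \<le> (\<Sum>j\<in>UNIV. (e i j (P $ i $ j) + e i j (Q $ i $ j)) / 2)"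
      using e_le unit by (intro ballI sum_mono) blast
    have "(\<Sum>j\<in>UNIV. e a j (P $ a $ j / 2 + Q $ a $ j / 2))
        < (\<Sum>j\<in>UNIV. (e a j (P $ a $ j) + e a j (Q $ a $ j)) / 2)"
      using e_le e_strict unit ab by (intro sum_strict_mono_ex1) (simp, blast, blast)
    then show "\<exists>i\<in>UNIV. (\<Sum>j\<in>UNIV. e i j (P $ i $ j / 2 + Q $ i $ j / 2))
        < (\<Sum>j\<in>UNIV. (e i j (P $ i $ j) + e i j (Q $ i $ j)) / 2)" by blast
  qed simp
  also have "\<dots> = (F P + F Q) / 2"
    by (simp add: F sum.distrib flip: sum_divide_distrib)
  finally show ?thesis .
qed

lemma F_has_derivative_along_line:
  assumes "P + s *\<^sub>R V \<in> pos_couplings"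
  shows "((\<lambda>s. F (P + s *\<^sub>R V)) has_real_derivative grad (P + s *\<^sub>R V) \<bullet> V) (at s)"
proof -
  have "((\<lambda>s. f (P $ i $ j + s * V $ i $ j)) has_real_derivative
      f' (P $ i $ j + s * V $ i $ j) * V $ i $ j) (at s)" for i j
    using pos_couplingsD(2,3)[OF assms, of i j]
    by (intro DERIV_chain2[OF deriv_f]) (auto intro!: derivative_eq_intros)
  note [derivative_intros] = this
  show ?thesis
    unfolding F_sum inner_matrix
    by (auto intro!: derivative_eq_intros sum.cong simp: grad_def algebra_simps)
qed

lemma grad_has_derivative_along_line:
  assumes "P + s *\<^sub>R V \<in> pos_couplings"
  shows "((\<lambda>s. grad (P + s *\<^sub>R V) \<bullet> V) has_real_derivative hess (P + s *\<^sub>R V) V) (at s)"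
proof -
  have "((\<lambda>s. f' (P $ i $ j + s * V $ i $ j)) has_real_derivative
      f'' (P $ i $ j + s * V $ i $ j) * V $ i $ j) (at s)" for i j
    using pos_couplingsD(2,3)[OF assms, of i j]
    by (intro DERIV_chain2[OF deriv_f']) (auto intro!: derivative_eq_intros)
  note [derivative_intros] = this
  show ?thesis
    unfolding grad_def hess_def inner_matrix
    by (auto intro!: derivative_eq_intros sum.cong
        simp: algebra_simps sum_distrib_left power2_eq_square)
qed

lemma compact_couplings: "compact (couplings x y)"
proof -
  have "closed (couplings x y)"
    unfolding couplings_def
    by (intro closed_Collect_conj closed_Collect_all closed_Collect_le closed_Collect_eq continuous_intros)
  moreover have "bounded (couplings x y)"
  proof -
    have "norm P \<le> (\<Sum>i\<in>(UNIV :: 'n option set). \<Sum>j\<in>(UNIV :: 'n option set). 1)"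
      if "P \<in> couplings x y" for P
    proof -
      have "norm (P $ i) \<le> (\<Sum>j\<in>(UNIV :: 'n option set). 1)" for i
        using coupling_entry_unit[OF that]
        by (intro order_trans[OF norm_le_l1_cart] sum_mono) auto
      then have "(\<Sum>i\<in>UNIV. norm (P $ i)) \<le> (\<Sum>i\<in>(UNIV :: 'n option set). \<Sum>j\<in>(UNIV :: 'n option set). 1)"
        by (intro sum_mono) blast
      moreover have "norm P \<le> (\<Sum>i\<in>UNIV. norm (P $ i))"
        unfolding norm_vec_def by (rule L2_set_le_sum) simp
      ultimately show ?thesis by linarith
    qed
    then show ?thesis by (auto intro: boundedI)
  qed
  ultimately show ?thesis by (simp add: compact_eq_bounded_closed)
qed

lemma continuous_on_F: "continuous_on (couplings x y) F"
proof -
  have "continuous_on (couplings x y) (\<lambda>P. f (P $ i $ j))" for i j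
    by (rule continuous_on_compose2[OF continuous])
       (use coupling_entry_unit in \<open>auto intro!: continuous_intros simp del: atLeastAtMost_iff\<close>)
  then show ?thesis
    unfolding F_sum by (auto intro!: continuous_intros)
qed

section \<open>Riemannian gradient\<close>

lemma partial_coord_cost:
  assumes "Z \<in> coord_domain x y"
  shows "partial (coord_cost f \<gamma> C x y) Z k l
    = (let A = grad (Phi x y Z)
       in A $ Some k $ Some l - A $ Some k $ None - A $ None $ Some l + A $ None $ None)"
proof -
  let ?A = "grad (Phi x y Z)" and ?V = "dPhi (axis k (axis l 1)) :: real ^ 'n option ^ 'n option"
  define a where "a m i = (case i of Some i' \<Rightarrow> if i' = m then 1 else 0 | None \<Rightarrow> (- 1 :: real))"
    for m :: 'n and i
  have V: "?V $ i $ j = a k i * a l j" for i j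
  proof -
    have ax: "(axis k (axis l 1) :: real ^ 'n ^ 'n) $ i $ j = (if i = k then 1 else 0) * (if j = l then 1 else 0)" for i j
      by (simp add: axis_def)
    show ?thesis
      by (cases i; cases j) (simp_all add: a_def ax flip: sum_distrib_left sum_distrib_right)
  qed
  have a: "(\<Sum>i\<in>UNIV. a m i * b i) = b (Some m) - b None" for m b
    by (simp add: sum_UNIV_option a_def if_distrib[of "\<lambda>z. z * _"] cong: if_cong)
  have "((\<lambda>s. F (Phi x y Z + s *\<^sub>R ?V)) has_real_derivative grad (Phi x y Z + 0 *\<^sub>R ?V) \<bullet> ?V) (at 0)"
    using assms by (intro F_has_derivative_along_line) (simp add: Phi_in_pos_couplings)
  then have "partial (coord_cost f \<gamma> C x y) Z k l = ?A \<bullet> ?V"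
    unfolding partial_def coord_cost_def Phi_add_scaleR by (intro DERIV_imp_deriv) simp
  also have "\<dots> = ?A $ Some k $ Some l - ?A $ Some k $ None - ?A $ None $ Some l + ?A $ None $ None"
  proof -
    have "?A \<bullet> ?V = (\<Sum>i\<in>UNIV. a k i * (\<Sum>j\<in>UNIV. a l j * ?A $ i $ j))"
      unfolding inner_matrix V sum_distrib_left by (simp add: mult_ac)
    then show ?thesis by (simp add: a)
  qed
  finally show ?thesis by (simp add: Let_def)
qed

text \<open>
  The Riemannian gradient as a matrix. The steps go in the opposite direction.
\<close>

definition direction :: "real ^ 'n option ^ 'n option \<Rightarrow> real ^ 'n option ^ 'n option" where
  "direction P = center (grad P)"

lemma direction_tangent: "direction P \<in> tangent"
  unfolding direction_def by (rule center_tangent)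

lemma inner_direction: "V \<in> tangent \<Longrightarrow> grad P \<bullet> V = direction P \<bullet> V"
  unfolding direction_def by (simp add: inner_center)

lemma dPhi_rgrad:
  assumes "Z \<in> coord_domain x y"
  shows "dPhi (rgrad f \<gamma> C x y Z) = direction (Phi x y Z)"
proof -
  have "rgrad f \<gamma> C x y Z = chart (direction (Phi x y Z))"
    by (simp add: vec_eq_iff rgrad_def partial_coord_cost[OF assms] inv_metric_contraction
        Let_def direction_def)
  then show ?thesis using dPhi_chart[OF direction_tangent] by simp
qed

lemma rgrad_eq_0_iff:
  assumes "Z \<in> coord_domain x y"
  shows "rgrad f \<gamma> C x y Z = 0 \<longleftrightarrow> direction (Phi x y Z) = 0"
proof -
  have "D = 0 \<longleftrightarrow> dPhi D = 0" for D :: "real ^ 'n ^ 'n"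
  proof
    assume "D = 0"
    then show "dPhi D = 0" by (intro matrix_option_eqI) simp_all
  next
    assume "dPhi D = 0"
    then have "dPhi D $ Some i $ Some j = 0" for i j by simp
    then show "D = 0" by (simp add: vec_eq_iff)
  qed
  then show ?thesis using dPhi_rgrad[OF assms] by simp
qed

lemma sqlen_eq:
  assumes "Z \<in> coord_domain x y"
  shows "sqlen f \<gamma> C x y Z = (norm (direction (Phi x y Z)))\<^sup>2"
  unfolding sqlen_def metric_contraction dPhi_rgrad[OF assms] by (simp add: power2_norm_eq_inner)

section \<open>Step bounds\<close>

text \<open>
  The step bound for one entry \<open>p\<close> that changes at rate \<open>- h\<close>. The bounds for entries, rows, columns
  and corner in the coordinates \<open>Z\<close> are this single bound for the entries of \<open>\<Phi>(Z)\<close>.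
\<close>

definition room :: "real \<Rightarrow> real \<Rightarrow> real" where
  "room p h = (if h > 0 then p / (2 * h) else 1)"

lemma eps_eq:
  assumes "Z \<in> coord_domain x y"
  shows "eps f \<gamma> C x y Z
    = Min (range (\<lambda>(i, j). room (Phi x y Z $ i $ j) (direction (Phi x y Z) $ i $ j)))"
proof -
  define D where "D = rgrad f \<gamma> C x y Z"
  define r where "r i j = room (Phi x y Z $ i $ j) (dPhi D $ i $ j)" for i j
  have "eps_row x Z D i = r (Some i) None" "eps_col y Z D j = r None (Some j)"
    "eps_entry Z D i j = r (Some i) (Some j)" "eps_corner x y Z D = r None None" for i j
    by (simp_all add: eps_row_def eps_col_def eps_entry_def eps_corner_def room_def r_def)
  then have "range (eps_row x Z D) \<union> range (eps_col y Z D)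
      \<union> range (\<lambda>(i, j). eps_entry Z D i j) \<union> {eps_corner x y Z D}
    = range (\<lambda>i. r (Some i) None) \<union> range (\<lambda>j. r None (Some j))
      \<union> range (\<lambda>(i, j). r (Some i) (Some j)) \<union> {r None None}"
    by simp
  also have "\<dots> = range (\<lambda>(i, j). r i j)"
  proof (intro subset_antisym subsetI)
    fix a assume "a \<in> range (\<lambda>(i, j). r i j)"
    then obtain i j where "a = r i j" by auto
    then show "a \<in> range (\<lambda>i. r (Some i) None) \<union> range (\<lambda>j. r None (Some j))
      \<union> range (\<lambda>(i, j). r (Some i) (Some j)) \<union> {r None None}"
      by (cases i; cases j) (auto simp: image_iff)
  qed (auto simp: image_iff)
  finally show ?thesis
    unfolding eps_def Let_def D_def[symmetric] r_def dPhi_rgrad[OF assms, folded D_def] by simp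
qed

lemma eps_pos:
  assumes "Z \<in> coord_domain x y"
  shows "0 < eps f \<gamma> C x y Z"
  unfolding eps_eq[OF assms]
  using pos_couplingsD(2)[of "Phi x y Z"] assms
  by (subst Min_gr_iff) (auto simp: room_def Phi_in_pos_couplings)

lemma eps_lower_bound:
  assumes "Z \<in> coord_domain x y" "0 < B"
    and "\<And>i j. \<delta> \<le> Phi x y Z $ i $ j" "\<And>i j. direction (Phi x y Z) $ i $ j \<le> B" "0 \<le> \<delta>"
  shows "min 1 (\<delta> / (2 * B)) \<le> eps f \<gamma> C x y Z"
proof -
  have "min 1 (\<delta> / (2 * B)) \<le> room (Phi x y Z $ i $ j) (direction (Phi x y Z) $ i $ j)" for i j
  proof (cases "0 < direction (Phi x y Z) $ i $ j")
    case True
    have "\<delta> / (2 * B) \<le> Phi x y Z $ i $ j / (2 * direction (Phi x y Z) $ i $ j)"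
      using assms(2) True assms(4)[of i j] assms(5) assms(3)[of i j]
      by (intro frac_le) linarith+
    then show ?thesis using True by (simp add: room_def)
  qed (simp add: room_def)
  then show ?thesis
    unfolding eps_eq[OF assms(1)] by (subst Min_ge_iff) auto
qed

lemma half_entry_le:
  assumes "Z \<in> coord_domain x y" "t \<in> {0..eps f \<gamma> C x y Z}"
  shows "Phi x y Z $ i $ j / 2 \<le> (Phi x y Z - t *\<^sub>R direction (Phi x y Z)) $ i $ j"
proof -
  let ?p = "Phi x y Z $ i $ j" and ?h = "direction (Phi x y Z) $ i $ j"
  have p: "0 < ?p" using assms(1) by (simp add: pos_couplingsD(2) Phi_in_pos_couplings)
  have "eps f \<gamma> C x y Z \<le> room ?p ?h"
    unfolding eps_eq[OF assms(1)] by (rule Min_le) (auto simp: image_iff)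
  then have t: "0 \<le> t" "t \<le> room ?p ?h" using assms(2) by auto
  have "t * ?h \<le> ?p / 2"
  proof (cases "0 < ?h")
    case True
    then show ?thesis using t by (simp add: room_def field_simps)
  next
    case False
    then have "t * ?h \<le> 0" using t(1) by (simp add: mult_nonneg_nonpos)
    then show ?thesis using p by linarith
  qed
  then show ?thesis by simp
qed

lemma segment_in_coord_domain:
  assumes "Z \<in> coord_domain x y" "t \<in> {0..eps f \<gamma> C x y Z}"
  shows "Z - t *\<^sub>R rgrad f \<gamma> C x y Z \<in> coord_domain x y"
proof -
  have "0 < Phi x y (Z - t *\<^sub>R rgrad f \<gamma> C x y Z) $ i $ j" for i j
    unfolding Phi_diff_scaleR dPhi_rgrad[OF assms(1)]
    using half_entry_le[OF assms, of i j] pos_couplingsD(2)[of "Phi x y Z" i j] assms(1)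
    by (simp add: Phi_in_pos_couplings)
  then show ?thesis by (simp add: coord_domain_iff[OF x_simplex y_simplex x_pos])
qed

lemma segment_in_pos_couplings:
  assumes "Z \<in> coord_domain x y" "t \<in> {0..eps f \<gamma> C x y Z}"
  shows "Phi x y Z - t *\<^sub>R direction (Phi x y Z) \<in> pos_couplings"
  using segment_in_coord_domain[OF assms]
  by (simp add: Phi_diff_scaleR dPhi_rgrad[OF assms(1)] flip: Phi_in_pos_couplings)

lemma line_cost_eq:
  assumes "Z \<in> coord_domain x y"
  shows "line_cost f \<gamma> C x y Z = (\<lambda>t. F (Phi x y Z + t *\<^sub>R (- direction (Phi x y Z))))"
  by (rule ext) (simp add: line_cost_def Phi_diff_scaleR dPhi_rgrad[OF assms])

text \<open>
  Openness makes the formulas for the derivatives of \<open>line_cost\<close> valid in a two-sided neighbourhood of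
  every point of the closed interval \<open>[0, \<epsilon>(Z)]\<close>, which the second derivative requires.
\<close>

lemma open_coord_domain: "open (coord_domain x y)"
proof -
  have "open {Z. 0 < Phi x y Z $ i $ j}" for i j
    by (cases i; cases j)
       (auto simp: Phi_corner[OF x_simplex y_simplex] intro!: open_Collect_less continuous_intros)
  then have "open (\<Inter>i j. {Z. 0 < Phi x y Z $ i $ j})"
    by (intro open_INT) auto
  moreover have "coord_domain x y = (\<Inter>i j. {Z. 0 < Phi x y Z $ i $ j})"
    by (auto simp: coord_domain_iff[OF x_simplex y_simplex x_pos])
  ultimately show ?thesis by simp
qed

lemma deriv_line_cost:
  fixes Z t
  defines "P \<equiv> Phi x y Z"
  assumes Z: "Z \<in> coord_domain x y" and t: "t \<in> {0..eps f \<gamma> C x y Z}"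
  shows "(line_cost f \<gamma> C x y Z has_real_derivative
      - (grad (P - t *\<^sub>R direction P) \<bullet> direction P)) (at t)" (is ?first)
    and "(deriv (line_cost f \<gamma> C x y Z) has_real_derivative
      hess (P - t *\<^sub>R direction P) (direction P)) (at t)" (is ?second)
proof -
  let ?H = "direction P"
  define T where "T = {s. P + s *\<^sub>R (- ?H) \<in> pos_couplings}"
  have T: "T = (\<lambda>s. Z - s *\<^sub>R rgrad f \<gamma> C x y Z) -` coord_domain x y"
    unfolding T_def P_def
    by (auto simp: Phi_diff_scaleR dPhi_rgrad[OF Z] simp flip: Phi_in_pos_couplings)
  have "open T"
    unfolding T by (intro open_vimage open_coord_domain continuous_intros)
  have tT: "t \<in> T" unfolding T using segment_in_coord_domain[OF Z t] by simp
  have d: "(line_cost f \<gamma> C x y Z has_real_derivative grad (P + s *\<^sub>R (- ?H)) \<bullet> (- ?H)) (at s)"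
    if "s \<in> T" for s
    unfolding line_cost_eq[OF Z] P_def[symmetric]
    using that by (intro F_has_derivative_along_line) (simp add: T_def)
  show ?first using d[OF tT] by simp
  have "hess (P + t *\<^sub>R (- ?H)) (- ?H) = hess (P - t *\<^sub>R ?H) ?H"
    by (simp add: hess_def)
  then have "((\<lambda>s. grad (P + s *\<^sub>R (- ?H)) \<bullet> (- ?H)) has_real_derivative
      hess (P - t *\<^sub>R ?H) ?H) (at t)"
    using tT grad_has_derivative_along_line[of P t "- ?H"] by (simp add: T_def)
  moreover have "grad (P + s *\<^sub>R (- ?H)) \<bullet> (- ?H) = deriv (line_cost f \<gamma> C x y Z) s" if "s \<in> T" for s
    using DERIV_imp_deriv[OF d[OF that]] by simp
  ultimately show ?second
    by (rule has_field_derivative_transform_within_open[OF _ \<open>open T\<close> tT])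
qed

lemma continuous_on_hess_line:
  assumes "Z \<in> coord_domain x y"
  shows "continuous_on {0..eps f \<gamma> C x y Z}
    (\<lambda>t. hess (Phi x y Z - t *\<^sub>R direction (Phi x y Z)) (direction (Phi x y Z)))"
proof -
  have "continuous_on {0..eps f \<gamma> C x y Z}
      (\<lambda>t. f'' ((Phi x y Z - t *\<^sub>R direction (Phi x y Z)) $ i $ j))" for i j
  proof (rule continuous_on_compose2[OF continuous_deriv2])
    show "(\<lambda>t. (Phi x y Z - t *\<^sub>R direction (Phi x y Z)) $ i $ j) ` {0..eps f \<gamma> C x y Z} \<subseteq> {0<..1}"
    proof (rule image_subsetI)
      fix t assume "t \<in> {0..eps f \<gamma> C x y Z}"
      note pos = segment_in_pos_couplings[OF assms this]
      show "(Phi x y Z - t *\<^sub>R direction (Phi x y Z)) $ i $ j \<in> {0<..1}"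
        using pos_couplingsD(2)[OF pos, of i j] pos_couplingsD(3)[OF pos, of i j] by auto
    qed
  qed (auto intro!: continuous_intros)
  then show ?thesis
    unfolding hess_def by (auto intro!: continuous_intros)
qed

lemma D2_attained:
  assumes Z: "Z \<in> coord_domain x y"
  defines "h \<equiv> \<lambda>t. hess (Phi x y Z - t *\<^sub>R direction (Phi x y Z)) (direction (Phi x y Z))"
  shows "\<exists>t\<in>{0..eps f \<gamma> C x y Z}. D2 f \<gamma> C x y Z = h t
    \<and> (\<forall>s\<in>{0..eps f \<gamma> C x y Z}. h s \<le> D2 f \<gamma> C x y Z)"
proof -
  let ?I = "{0..eps f \<gamma> C x y Z}"
  have "?I \<noteq> {}" using eps_pos[OF Z] by auto
  then obtain t where t: "t \<in> ?I" "\<And>s. s \<in> ?I \<Longrightarrow> h s \<le> h t"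
    using continuous_attains_sup[OF compact_Icc _ continuous_on_hess_line[OF Z]]
    unfolding h_def by blast
  have "D2 f \<gamma> C x y Z = (SUP s\<in>?I. h s)"
    unfolding D2_def h_def using DERIV_imp_deriv[OF deriv_line_cost(2)[OF Z]] by simp
  also have "\<dots> = h t"
    using t by (intro cSup_eq_maximum) auto
  finally show ?thesis using t by (intro bexI[of _ t]) auto
qed

lemma hess_nonneg: "P \<in> pos_couplings \<Longrightarrow> 0 \<le> hess P V"
  unfolding hess_def
  by (rule mult_nonneg_nonneg[OF less_imp_le[OF gamma_pos]], rule sum_nonneg, rule sum_nonneg)
     (rule mult_nonneg_nonneg[OF f''_nonneg[OF pos_couplingsD(2,3)] zero_le_power2], assumption+)

lemma hess_le:
  assumes "\<And>i j. f'' (P $ i $ j) \<le> M"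
  shows "hess P V \<le> \<gamma> * M * (norm V)\<^sup>2"
proof -
  have "(\<Sum>i\<in>UNIV. \<Sum>j\<in>UNIV. f'' (P $ i $ j) * (V $ i $ j)\<^sup>2)
      \<le> (\<Sum>i\<in>UNIV. \<Sum>j\<in>UNIV. M * (V $ i $ j)\<^sup>2)"
    using assms by (intro sum_mono mult_right_mono) auto
  also have "\<dots> = M * (norm V)\<^sup>2"
    unfolding power2_norm_eq_inner inner_matrix sum_distrib_left by (simp add: power2_eq_square)
  finally show ?thesis
    unfolding hess_def using gamma_pos by (simp add: mult.assoc)
qed

lemma D2_nonneg:
  assumes "Z \<in> coord_domain x y"
  shows "0 \<le> D2 f \<gamma> C x y Z"
  using D2_attained[OF assms] hess_nonneg[OF segment_in_pos_couplings[OF assms]] by auto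

text \<open>
  If \<open>D\<^sub>2 = 0\<close>, then the nonnegative second derivative vanishes on all of \<open>[0, \<epsilon>(Z)]\<close>. An entry along which the
  segment moves would sweep an interval on which \<open>f'\<close> is constant.
\<close>

lemma D2_eq_0_iff:
  assumes Z: "Z \<in> coord_domain x y"
  shows "D2 f \<gamma> C x y Z = 0 \<longleftrightarrow> direction (Phi x y Z) = 0"
proof
  assume H: "direction (Phi x y Z) = 0"
  show "D2 f \<gamma> C x y Z = 0"
    using D2_attained[OF Z] unfolding H by (simp add: hess_def)
next
  let ?P = "Phi x y Z" and ?H = "direction (Phi x y Z)" and ?e = "eps f \<gamma> C x y Z"
  assume 0: "D2 f \<gamma> C x y Z = 0"
  show "?H = 0"
  proof (rule ccontr)
    assume "?H \<noteq> 0"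
    then obtain i j where h: "?H $ i $ j \<noteq> 0" by (auto simp: vec_eq_iff)
    define q where "q t = ?P $ i $ j - t * ?H $ i $ j" for t
    have q: "0 < q t" "q t < 1" if "t \<in> {0..?e}" for t
      using pos_couplingsD(2,3)[OF segment_in_pos_couplings[OF Z that], of i j] by (simp_all add: q_def)
    have zero: "f'' (q t) = 0" if t: "t \<in> {0..?e}" for t
    proof -
      define Q where "Q = ?P - t *\<^sub>R ?H"
      have pos: "Q \<in> pos_couplings" unfolding Q_def by (rule segment_in_pos_couplings[OF Z t])
      have "hess Q ?H \<le> 0"
        using D2_attained[OF Z] 0 t unfolding Q_def by auto
      then have "(\<Sum>i\<in>UNIV. \<Sum>j\<in>UNIV. f'' (Q $ i $ j) * (?H $ i $ j)\<^sup>2) \<le> 0"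
        using gamma_pos by (simp add: hess_def mult_le_0_iff)
      moreover have nn: "0 \<le> f'' (Q $ i $ j) * (?H $ i $ j)\<^sup>2" for i j
        by (rule mult_nonneg_nonneg[OF f''_nonneg[OF pos_couplingsD(2,3)[OF pos]] zero_le_power2])
      moreover have "f'' (Q $ i $ j) * (?H $ i $ j)\<^sup>2
          \<le> (\<Sum>j\<in>UNIV. f'' (Q $ i $ j) * (?H $ i $ j)\<^sup>2)"
        by (rule member_le_sum) (use nn in auto)
      moreover have "(\<Sum>j\<in>UNIV. f'' (Q $ i $ j) * (?H $ i $ j)\<^sup>2)
          \<le> (\<Sum>i\<in>UNIV. \<Sum>j\<in>UNIV. f'' (Q $ i $ j) * (?H $ i $ j)\<^sup>2)"
        by (rule member_le_sum) (use nn in \<open>auto intro: sum_nonneg\<close>)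
      ultimately have "f'' (Q $ i $ j) * (?H $ i $ j)\<^sup>2 = 0"
        using nn[of i j] by linarith
      then show ?thesis using h by (simp add: Q_def q_def)
    qed
    have "((\<lambda>t. f' (q t)) has_real_derivative 0) (at t within {0..?e})" if t: "t \<in> {0..?e}" for t
    proof -
      have "(q has_real_derivative - ?H $ i $ j) (at t)"
        unfolding q_def by (auto intro!: derivative_eq_intros)
      from DERIV_chain2[OF deriv_f'[OF q[OF t]] this] show ?thesis
        by (simp add: zero[OF t] has_field_derivative_at_within)
    qed
    then obtain c where "\<forall>t\<in>{0..?e}. f' (q t) = c"
      using has_field_derivative_zero_constant[of "{0..?e}" "\<lambda>t. f' (q t)"] by auto
    then have eq: "f' (q ?e) = f' (q 0)"
      using eps_pos[OF Z] by simp
    have ends: "0 < q 0" "q 0 < 1" "0 < q ?e" "q ?e < 1"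
      using q[of 0] q[of ?e] eps_pos[OF Z] by auto
    have "q ?e \<noteq> q 0" using h eps_pos[OF Z] by (simp add: q_def)
    then consider "q ?e < q 0" | "q 0 < q ?e" by linarith
    then show False
      using f'_strict_mono[of "q ?e" "q 0"] f'_strict_mono[of "q 0" "q ?e"] ends eq by cases simp_all
  qed
qed

section \<open>Descent estimates\<close>

definition iterate :: "nat \<Rightarrow> real ^ 'n option ^ 'n option" where
  "iterate n = Phi x y (descent f \<gamma> C x y n)"

definition step :: "nat \<Rightarrow> real" where
  "step n = step_size f \<gamma> C x y (descent f \<gamma> C x y n)"

lemma step_size_bounds:
  assumes "Z \<in> coord_domain x y"
  shows "step_size f \<gamma> C x y Z \<in> {0..eps f \<gamma> C x y Z}"
  using D2_nonneg[OF assms] eps_pos[OF assms] sqlen_eq[OF assms]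
  by (auto simp: step_size_def)

lemma Phi_descent_0: "Phi x y (descent f \<gamma> C x y 0) = outer x y"
  and descent_0_in_coord_domain: "descent f \<gamma> C x y 0 \<in> coord_domain x y"
proof -
  have "Phi x y (chart (outer x y)) = outer x y"
    by (rule Phi_chart[OF x_simplex y_simplex pos_couplingsD(1)[OF outer_pos_coupling]])
  moreover from this have "chart (outer x y) \<in> coord_domain x y"
    using outer_pos_coupling by (simp flip: Phi_in_pos_couplings)
  ultimately have "outer x y \<in> Phi x y ` coord_domain x y" by force
  then show "Phi x y (descent f \<gamma> C x y 0) = outer x y"
    and "descent f \<gamma> C x y 0 \<in> coord_domain x y"
    by (simp_all add: f_inv_into_f inv_into_into)
qed

text \<open>
  The formula also covers the stopping case, where the direction is zero.
\<close>

lemma descent_Suc_eq: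
  "descent f \<gamma> C x y (Suc n) = descent f \<gamma> C x y n - step n *\<^sub>R rgrad f \<gamma> C x y (descent f \<gamma> C x y n)"
  by (simp add: Let_def step_def)

lemma descent_in_coord_domain: "descent f \<gamma> C x y n \<in> coord_domain x y"
proof (induction n)
  case 0
  show ?case by (rule descent_0_in_coord_domain)
next
  case (Suc n)
  show ?case
    unfolding descent_Suc_eq step_def by (rule segment_in_coord_domain[OF Suc step_size_bounds[OF Suc]])
qed

lemma iterate_pos: "iterate n \<in> pos_couplings"
  unfolding iterate_def Phi_in_pos_couplings by (rule descent_in_coord_domain)

lemmas iterate_coupling = pos_couplingsD(1)[OF iterate_pos]

lemma iterate_Suc: "iterate (Suc n) = iterate n - step n *\<^sub>R direction (iterate n)"
  unfolding iterate_def descent_Suc_eq Phi_diff_scaleR dPhi_rgrad[OF descent_in_coord_domain] ..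

lemma step_bounds: "0 \<le> step n" "step n \<le> eps f \<gamma> C x y (descent f \<gamma> C x y n)"
  using step_size_bounds[OF descent_in_coord_domain[of n]] by (auto simp: step_def)

lemma D2_pos:
  assumes "Z \<in> coord_domain x y" "direction (Phi x y Z) \<noteq> 0"
  shows "0 < D2 f \<gamma> C x y Z"
  using D2_nonneg[OF assms(1)] D2_eq_0_iff[OF assms(1)] assms(2) by linarith

lemma step_pos:
  assumes "direction (iterate n) \<noteq> 0"
  shows "0 < step n"
proof -
  let ?Z = "descent f \<gamma> C x y n"
  note Z = descent_in_coord_domain[of n]
  have "0 < D2 f \<gamma> C x y ?Z" using D2_pos[OF Z] assms by (simp add: iterate_def)
  then show ?thesis
    using assms eps_pos[OF Z] by (simp add: step_def step_size_def sqlen_eq[OF Z] iterate_def)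
qed

text \<open>
  The second derivative along the step is at most \<open>D\<^sub>2\<close>, and \<open>t D\<^sub>2 \<le> |H|\<^sup>2\<close>. So the quadratic term of
  the Taylor bound uses up at most half of the linear gain \<open>t |H|\<^sup>2\<close>.
\<close>

lemma sufficient_decrease:
  "F (iterate (Suc n)) \<le> F (iterate n) - step n * (norm (direction (iterate n)))\<^sup>2 / 2"
proof -
  let ?Z = "descent f \<gamma> C x y n" and ?P = "iterate n" and ?t = "step n" and ?H = "direction (iterate n)"
  let ?D2 = "D2 f \<gamma> C x y ?Z"
  note Z = descent_in_coord_domain[of n]
  have tD2: "?t * ?D2 \<le> (norm ?H)\<^sup>2"
  proof (cases "?D2 = 0")
    case False
    then have "0 < ?D2" using D2_nonneg[OF Z] by simp
    moreover have "?t \<le> (norm ?H)\<^sup>2 / ?D2"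
      by (simp add: step_def step_size_def sqlen_eq[OF Z] iterate_def)
    ultimately show ?thesis by (simp add: field_simps)
  qed simp
  have "line_cost f \<gamma> C x y ?Z ?t \<le> line_cost f \<gamma> C x y ?Z 0
      + ?t * (- (grad (?P - 0 *\<^sub>R ?H) \<bullet> ?H)) + ?D2 * ?t\<^sup>2 / 2"
  proof (rule second_order_upper_bound)
    fix s assume "s \<in> {0..?t}"
    then have s: "s \<in> {0..eps f \<gamma> C x y ?Z}" using step_bounds[of n] by auto
    show "(line_cost f \<gamma> C x y ?Z has_real_derivative - (grad (?P - s *\<^sub>R ?H) \<bullet> ?H)) (at s)"
      using deriv_line_cost(1)[OF Z s] by (simp add: iterate_def)
    have "((\<lambda>s. grad (?P + s *\<^sub>R (- ?H)) \<bullet> (- ?H)) has_real_derivative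
        hess (?P + s *\<^sub>R (- ?H)) (- ?H)) (at s)"
      using segment_in_pos_couplings[OF Z s]
      by (intro grad_has_derivative_along_line) (simp add: iterate_def)
    then show "((\<lambda>s. - (grad (?P - s *\<^sub>R ?H) \<bullet> ?H)) has_real_derivative hess (?P - s *\<^sub>R ?H) ?H) (at s)"
      by (simp add: hess_def)
    show "hess (?P - s *\<^sub>R ?H) ?H \<le> ?D2"
      using D2_attained[OF Z] s by (auto simp: iterate_def)
  qed (rule step_bounds)
  also have "?D2 * ?t\<^sup>2 / 2 \<le> ?t * (norm ?H)\<^sup>2 / 2"
    using mult_left_mono[OF tD2 step_bounds(1)[of n]] by (simp add: power2_eq_square mult_ac)
  also have "line_cost f \<gamma> C x y ?Z ?t = F (iterate (Suc n))"
    unfolding iterate_Suc by (simp add: line_cost_eq[OF Z] iterate_def)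
  also have "line_cost f \<gamma> C x y ?Z 0 = F ?P"
    by (simp add: line_cost_eq[OF Z] iterate_def)
  also have "grad (?P - 0 *\<^sub>R ?H) \<bullet> ?H = (norm ?H)\<^sup>2"
    by (simp add: inner_direction[OF direction_tangent] power2_norm_eq_inner)
  finally show ?thesis by simp
qed

lemma decseq_F: "decseq (\<lambda>n. F (iterate n))"
proof (rule decseq_SucI)
  fix n
  have "0 \<le> step n * (norm (direction (iterate n)))\<^sup>2 / 2" using step_bounds(1) by simp
  then show "F (iterate (Suc n)) \<le> F (iterate n)" using sufficient_decrease[of n] by linarith
qed

text \<open>
  Expanding the square, the linear term is controlled by convexity and the quadratic term \<open>t\<^sup>2 |H|\<^sup>2\<close> by
  \<open>sufficient_decrease\<close>, which replaces \<open>F (iterate n)\<close> by \<open>F (iterate (Suc n))\<close>. A step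
  to a matrix that costs at least as much as \<open>R\<close> therefore does not lead away from \<open>R\<close>.
\<close>

lemma dist_to_coupling:
  assumes "R \<in> couplings x y"
  shows "2 * step n * (F (iterate (Suc n)) - F R)
    \<le> (norm (iterate n - R))\<^sup>2 - (norm (iterate (Suc n) - R))\<^sup>2"
proof -
  let ?P = "iterate n" and ?t = "step n" and ?H = "direction (iterate n)"
  have "(norm (iterate (Suc n) - R))\<^sup>2 = (norm (?P - R))\<^sup>2 - 2 * ?t * (?H \<bullet> (?P - R)) + ?t * (?t * (norm ?H)\<^sup>2)"
    unfolding iterate_Suc power2_norm_eq_inner
    by (simp add: inner_diff_left inner_diff_right inner_commute algebra_simps)
  moreover have "F ?P - F R \<le> ?H \<bullet> (?P - R)"
  proof -
    have "F ?P + grad ?P \<bullet> (R - ?P) \<le> F R" by (rule F_above_tangent[OF iterate_pos assms])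
    moreover have "grad ?P \<bullet> (R - ?P) = ?H \<bullet> (R - ?P)"
      by (rule inner_direction[OF diff_couplings_tangent[OF assms iterate_coupling]])
    ultimately show ?thesis by (simp add: inner_diff_right)
  qed
  then have "2 * ?t * (F ?P - F R) \<le> 2 * ?t * (?H \<bullet> (?P - R))"
    using step_bounds(1)[of n] by (intro mult_left_mono) auto
  moreover have "?t * (?t * (norm ?H)\<^sup>2) \<le> ?t * (2 * (F ?P - F (iterate (Suc n))))"
    using sufficient_decrease[of n] step_bounds(1)[of n] by (intro mult_left_mono) auto
  ultimately show ?thesis by (simp add: algebra_simps)
qed

text \<open>
  Both sums telescope: the first by \<open>dist_to_coupling\<close>, the second by \<open>sufficient_decrease\<close> together
  with \<open>|H| \<le> 1 + |H|\<^sup>2\<close>.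
\<close>

lemma summable_step:
  assumes R: "R \<in> couplings x y" and "0 < c" and gap: "\<And>n. c \<le> F (iterate n) - F R"
  shows "summable step" and "summable (\<lambda>n. step n * norm (direction (iterate n)))"
proof -
  have "summable (\<lambda>n. 2 * c * step n)"
  proof (rule summable_if_le_decrease)
    fix n
    show "0 \<le> 2 * c * step n" using \<open>0 < c\<close> step_bounds(1)[of n] by simp
    have "step n * c \<le> step n * (F (iterate (Suc n)) - F R)"
      using gap step_bounds(1) by (rule mult_left_mono)
    then show "2 * c * step n \<le> (norm (iterate n - R))\<^sup>2 - (norm (iterate (Suc n) - R))\<^sup>2"
      using dist_to_coupling[OF R, of n] by (simp add: mult_ac)
    show "0 \<le> (norm (iterate n - R))\<^sup>2" by simp
  qed
  then show step: "summable step"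
    using \<open>0 < c\<close> by (simp add: summable_cmult_iff)
  have "summable (\<lambda>n. step n * (norm (direction (iterate n)))\<^sup>2 / 2)"
    by (rule summable_if_le_decrease[where u = "\<lambda>n. F (iterate n)" and c = "F R + c"])
       (use gap sufficient_decrease step_bounds(1) in \<open>auto simp: algebra_simps\<close>)
  then have "summable (\<lambda>n. step n + step n * (norm (direction (iterate n)))\<^sup>2)"
    using step by (intro summable_add) (simp_all add: summable_divide_iff)
  then show "summable (\<lambda>n. step n * norm (direction (iterate n)))"
  proof (rule summable_comparison_test')
    fix n
    have "a \<le> 1 + a\<^sup>2" for a :: real
    proof -
      have "2 * a \<le> 1 + a\<^sup>2" using zero_le_power2[of "a - 1"] by (simp add: power2_diff)
      then show ?thesis using zero_le_power2[of a] by linarith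
    qed
    then have "norm (direction (iterate n)) \<le> 1 + (norm (direction (iterate n)))\<^sup>2" .
    then have "step n * norm (direction (iterate n)) \<le> step n * (1 + (norm (direction (iterate n)))\<^sup>2)"
      using step_bounds(1) by (rule mult_left_mono)
    then show "norm (step n * norm (direction (iterate n))) \<le> step n + step n * (norm (direction (iterate n)))\<^sup>2"
      using step_bounds(1)[of n] by (simp add: algebra_simps)
  qed
qed

section \<open>Convergence of the iterates\<close>

text \<open>
  Entries with \<open>Q $ i $ j = 0\<close> contribute \<open>- \<gamma> f'(P\<^sub>i\<^sub>j) V\<^sub>i\<^sub>j \<longlongrightarrow> \<infinity>\<close> up to a constant, however fast the
  individual entries vanish, since all these \<open>V\<^sub>i\<^sub>j\<close> are positive. The other entries converge.
\<close>

lemma grad_inner_at_top: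
  assumes lim: "P \<longlonglongrightarrow> Q" and P: "\<And>n. P n \<in> pos_couplings" and Q: "Q \<in> couplings x y"
    and V: "\<And>i j. Q $ i $ j = 0 \<Longrightarrow> 0 < V $ i $ j" and zero: "Q $ a $ b = 0"
  shows "filterlim (\<lambda>n. - (grad (P n) \<bullet> V)) at_top sequentially"
proof -
  define g where "g = (\<lambda>(i, j) n. - (grad (P n) $ i $ j * V $ i $ j))"
  define S where "S = {(i, j). Q $ i $ j = 0}"
  have entry: "(\<lambda>n. P n $ i $ j) \<longlonglongrightarrow> Q $ i $ j" for i j
    using lim by (intro tendsto_vec_nth)
  have "filterlim (\<lambda>n. \<Sum>p\<in>S. g p n) at_top sequentially"
  proof (rule filterlim_sum_at_top)
    show "S \<noteq> {}" using zero by (auto simp: S_def)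
    fix p assume p: "p \<in> S"
    obtain i j where ij: "p = (i, j)" by (cases p)
    have Q0: "Q $ i $ j = 0" using p by (simp add: S_def ij)
    have "filterlim (\<lambda>n. P n $ i $ j) (at_right 0) sequentially"
      using entry[of i j] unfolding Q0
      by (rule tendsto_imp_filterlim_at_right) (simp add: pos_couplingsD(2)[OF P])
    then have "filterlim (\<lambda>n. f' (P n $ i $ j)) at_bot sequentially"
      by (rule filterlim_compose[OF deriv_at_0])
    then have "filterlim (\<lambda>n. - f' (P n $ i $ j)) at_top sequentially"
      by (simp add: filterlim_uminus_at_bot)
    then have "filterlim (\<lambda>n. (\<gamma> * V $ i $ j) * (- f' (P n $ i $ j))) at_top sequentially"
      using gamma_pos V[OF Q0] by (intro filterlim_tendsto_pos_mult_at_top[OF tendsto_const]) auto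
    then have "filterlim (\<lambda>n. (\<gamma> * deriv01 f (x $ i * y $ j) - C $ i $ j) * V $ i $ j
        + (\<gamma> * V $ i $ j) * (- f' (P n $ i $ j))) at_top sequentially"
      by (rule filterlim_tendsto_add_at_top[OF tendsto_const])
    then show "filterlim (g p) at_top sequentially"
      by (simp add: g_def ij grad_def algebra_simps)
  qed simp
  moreover have "(\<lambda>n. \<Sum>p\<in>- S. g p n) \<longlonglongrightarrow> (\<Sum>(i, j)\<in>- S. - (grad Q $ i $ j * V $ i $ j))"
  proof (rule tendsto_sum)
    fix p assume p: "p \<in> - S"
    obtain i j where ij: "p = (i, j)" by (cases p)
    have "0 < Q $ i $ j" "Q $ i $ j < 1"
      using p Q coupling_entry_less_1[OF Q] by (auto simp: S_def ij couplings_def less_le)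
    then have "isCont f' (Q $ i $ j)" by (intro DERIV_isCont[OF deriv_f'])
    then have "(\<lambda>n. f' (P n $ i $ j)) \<longlonglongrightarrow> f' (Q $ i $ j)"
      using entry by (rule isCont_tendsto_compose)
    then show "g p \<longlonglongrightarrow> (case p of (i, j) \<Rightarrow> - (grad Q $ i $ j * V $ i $ j))"
      by (auto simp: g_def ij grad_def intro!: tendsto_intros)
  qed
  ultimately have "filterlim (\<lambda>n. (\<Sum>p\<in>- S. g p n) + (\<Sum>p\<in>S. g p n)) at_top sequentially"
    by (intro filterlim_tendsto_add_at_top)
  moreover have "(\<Sum>p\<in>- S. g p n) + (\<Sum>p\<in>S. g p n) = - (grad (P n) \<bullet> V)" for n
  proof -
    have "(\<Sum>p\<in>- S. g p n) + (\<Sum>p\<in>S. g p n) = (\<Sum>p\<in>UNIV. g p n)"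
      by (subst sum.union_disjoint[symmetric]) (auto simp: Compl_partition2)
    also have "\<dots> = (\<Sum>i\<in>UNIV. \<Sum>j\<in>UNIV. g (i, j) n)"
      by (simp add: sum.cartesian_product g_def split_def)
    finally show ?thesis by (simp add: g_def inner_matrix sum_negf)
  qed
  ultimately show ?thesis by simp
qed

text \<open>
  The vector \<open>V\<close> is the element of least norm in the polyhedron \<open>K\<close> of tangent matrices that are at least
  \<open>1\<close> at the vanishing entries of \<open>Q\<close>. Moving from \<open>V\<close> by \<open>P - Q\<close> stays in \<open>K\<close>, so minimality forces
  \<open>V \<bullet> (P - Q) \<ge> 0\<close>. Positivity of \<open>outer x y\<close> makes \<open>K\<close> nonempty.
\<close>

lemma inward_normal_exists:
  assumes Q: "Q \<in> couplings x y"
  shows "\<exists>V\<in>tangent. (\<forall>i j. Q $ i $ j = 0 \<longrightarrow> 0 < V $ i $ j) \<and> (\<forall>P\<in>couplings x y. 0 \<le> V \<bullet> (P - Q))"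
proof -
  define K where "K = {V \<in> tangent. \<forall>i j. Q $ i $ j = 0 \<longrightarrow> 1 \<le> V $ i $ j}"
  have closed: "closed K"
    unfolding K_def tangent_def mem_Collect_eq
    by (intro closed_Collect_conj closed_Collect_all closed_Collect_imp closed_Collect_le
        closed_Collect_eq continuous_intros) simp
  have convex: "convex K"
  proof (rule convexI)
    fix U V :: "real ^ 'n option ^ 'n option" and u v :: real
    assume U: "U \<in> K" and V: "V \<in> K" and uv: "0 \<le> u" "0 \<le> v" "u + v = 1"
    have "1 \<le> u * U $ i $ j + v * V $ i $ j" if "Q $ i $ j = 0" for i j
    proof -
      have "u * 1 + v * 1 \<le> u * U $ i $ j + v * V $ i $ j"
        using U V uv that by (intro add_mono mult_left_mono) (auto simp: K_def)
      then show ?thesis using uv by simp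
    qed
    then show "u *\<^sub>R U + v *\<^sub>R V \<in> K"
      using U V by (auto simp: K_def tangent_def sum.distrib simp flip: sum_distrib_left)
  qed
  \<comment> \<open>Dividing by \<open>m\<close> brings the entries of \<open>outer x y - Q\<close> where \<open>Q\<close> vanishes up to at least \<open>1\<close>.\<close>
  define m where "m = Min (range (\<lambda>(i, j). outer x y $ i $ j))"
  have m: "m \<le> outer x y $ i $ j" for i j
    unfolding m_def by (intro Min_le) (auto simp: image_iff)
  have "0 < m"
    unfolding m_def using pos_couplingsD(2)[OF outer_pos_coupling] by (subst Min_gr_iff) auto
  have "(1 / m) *\<^sub>R (outer x y - Q) \<in> K"
    using diff_couplings_tangent[OF pos_couplingsD(1)[OF outer_pos_coupling] Q] m \<open>0 < m\<close>
    by (auto simp: K_def tangent_def field_simps simp flip: sum_distrib_left sum_divide_distrib)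
  then have V: "closest_point K 0 \<in> K"
    using closed by (intro closest_point_in_set) auto
  let ?V = "closest_point K 0"
  have "0 \<le> ?V \<bullet> (P - Q)" if P: "P \<in> couplings x y" for P
  proof -
    have "?V + (P - Q) \<in> K"
      using V P diff_couplings_tangent[OF P Q]
      by (auto simp: K_def tangent_def sum.distrib couplings_def add_increasing2)
    then have "(0 - ?V) \<bullet> (?V + (P - Q) - ?V) \<le> 0"
      by (rule closest_point_dot[OF convex closed])
    then show ?thesis by simp
  qed
  moreover have "0 < ?V $ i $ j" if "Q $ i $ j = 0" for i j
  proof -
    have "1 \<le> W $ i $ j" if "W \<in> K" for W using that \<open>Q $ i $ j = 0\<close> by (simp add: K_def)
    from this[OF V] show ?thesis by linarith
  qed
  moreover have "K \<subseteq> tangent" by (auto simp: K_def)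
  ultimately show ?thesis using V by (intro bexI[of _ ?V]) auto
qed

text \<open>
  Close to a boundary point \<open>Q\<close> the steps increase the linear functional \<open>P \<mapsto> V \<bullet> (P - Q)\<close>, which is
  nonnegative on couplings; so it cannot tend to its value \<open>0\<close> at \<open>Q\<close>.
\<close>

lemma limit_in_pos_couplings:
  assumes lim: "iterate \<longlonglongrightarrow> Q" and nz: "\<And>n. direction (iterate n) \<noteq> 0"
  shows "Q \<in> pos_couplings"
proof (rule ccontr)
  assume nQ: "Q \<notin> pos_couplings"
  have Q: "Q \<in> couplings x y"
    using closed_sequentially[OF compact_imp_closed[OF compact_couplings] _ lim] iterate_coupling by blast
  then obtain a b where zero: "Q $ a $ b = 0"
    using nQ by (force simp: pos_couplings_def couplings_def less_le)
  obtain V where V: "\<And>i j. Q $ i $ j = 0 \<Longrightarrow> 0 < V $ i $ j" "V \<in> tangent"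
    "\<And>P. P \<in> couplings x y \<Longrightarrow> 0 \<le> V \<bullet> (P - Q)"
    using inward_normal_exists[OF Q] by blast
  define h where "h n = V \<bullet> (iterate n - Q)" for n
  have "filterlim (\<lambda>n. - (grad (iterate n) \<bullet> V)) at_top sequentially"
    using grad_inner_at_top[OF lim iterate_pos Q V(1) zero] .
  then have "eventually (\<lambda>n. 0 < - (grad (iterate n) \<bullet> V)) sequentially"
    unfolding filterlim_at_top_dense by (rule spec)
  then obtain n0 where n0: "\<And>n. n0 \<le> n \<Longrightarrow> 0 < - (grad (iterate n) \<bullet> V)"
    by (auto simp: eventually_sequentially)
  have inc: "h n < h (Suc n)" if "n0 \<le> n" for n
  proof -
    have "h (Suc n) = h n + step n * (- (grad (iterate n) \<bullet> V))"
      unfolding h_def iterate_Suc inner_direction[OF V(2)]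
      by (simp add: inner_diff_right inner_commute algebra_simps)
    then show ?thesis using mult_pos_pos[OF step_pos[OF nz] n0[OF that]] by simp
  qed
  have "h (Suc n0) \<le> h n" if "Suc n0 \<le> n" for n
    using that
  proof (induction n rule: dec_induct)
    case (step m)
    then show ?case using inc[of m] by simp
  qed simp
  moreover have "h \<longlonglongrightarrow> V \<bullet> (Q - Q)"
    unfolding h_def using lim by (intro tendsto_intros)
  ultimately have "h (Suc n0) \<le> V \<bullet> (Q - Q)"
    by (intro LIMSEQ_le_const) auto
  moreover have "0 \<le> h n0" using V(3)[OF iterate_coupling] by (simp add: h_def)
  ultimately show False using inc[of n0] by simp
qed

text \<open>
  On couplings with entries at least \<open>\<delta>\<close> the directions are bounded, which bounds \<open>\<epsilon>\<close> from below. Along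
  the segment the entries are at least \<open>\<delta> / 2\<close>, where \<open>f'' \<le> M\<close> for some \<open>M\<close>; then
  \<open>D\<^sub>2 \<le> \<gamma> M |H|\<^sup>2\<close>, so \<open>G / D\<^sub>2 \<ge> 1 / (\<gamma> M)\<close> however small \<open>H\<close> is.
\<close>

lemma step_bounded_below:
  assumes "0 < \<delta>" and nz: "\<And>n. direction (iterate n) \<noteq> 0"
  obtains \<tau> where "0 < \<tau>" "\<And>n. (\<And>i j. \<delta> \<le> iterate n $ i $ j) \<Longrightarrow> \<tau> \<le> step n"
proof -
  have cont: "continuous_on {\<delta>/2..1} f''"
    by (rule continuous_on_subset[OF continuous_deriv2]) (use assms(1) in auto)
  have "bounded (f'' ` {\<delta>/2..1})" 
    by (rule compact_imp_bounded[OF compact_continuous_image[OF cont compact_Icc]])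
  then obtain M where M: "0 < M" "\<And>u. u \<in> {\<delta>/2..1} \<Longrightarrow> f'' u \<le> M"
    unfolding bounded_pos by (metis abs_le_D1 imageI real_norm_def)
  define T where "T = {P \<in> couplings x y. \<forall>i j. \<delta> \<le> P $ i $ j}"
  have "compact T"
    unfolding T_def using compact_couplings
    by (intro compact_Int_closed[of "couplings x y" "{P. \<forall>i j. \<delta> \<le> P $ i $ j}", unfolded Int_def, simplified]
        closed_Collect_all closed_Collect_le continuous_intros)
  moreover have "continuous_on T direction"
  proof -
    have "continuous_on {\<delta>..1} f'"
      by (rule DERIV_continuous_on, rule DERIV_subset[OF deriv2_within]) (use assms(1) in auto)
    then have "continuous_on T (\<lambda>P. f' (P $ i $ j))" for i j
      by (rule continuous_on_compose2)
         (use coupling_entry_unit in \<open>auto simp: T_def intro!: continuous_intros\<close>)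
    then show ?thesis
      unfolding direction_def center_def grad_def
      by (auto intro!: continuous_intros)
  qed
  ultimately have "bounded (direction ` T)"
    by (intro compact_imp_bounded compact_continuous_image)
  then obtain B where B: "0 < B" "\<And>P. P \<in> T \<Longrightarrow> norm (direction P) \<le> B"
    unfolding bounded_pos by blast
  define \<tau> where "\<tau> = min (1 / (\<gamma> * M)) (min 1 (\<delta> / (2 * B)))"
  have "0 < \<tau>" using assms(1) B(1) M(1) gamma_pos by (simp add: \<tau>_def)
  moreover have "\<tau> \<le> step n" if ge: "\<And>i j. \<delta> \<le> iterate n $ i $ j" for n
  proof -
    let ?Z = "descent f \<gamma> C x y n" and ?P = "iterate n" and ?H = "direction (iterate n)"
    note Z = descent_in_coord_domain[of n]
    have P: "Phi x y ?Z = ?P" by (simp add: iterate_def)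
    have "?P \<in> T" using ge iterate_coupling by (simp add: T_def)
    then have "?H $ i $ j \<le> B" for i j
      using component_le_norm_cart[of "?H $ i" j] Finite_Cartesian_Product.norm_nth_le[of ?H i] B(2)[of ?P]
      by linarith
    then have "min 1 (\<delta> / (2 * B)) \<le> eps f \<gamma> C x y ?Z"
      using assms(1) B(1) ge by (intro eps_lower_bound[OF Z]) (auto simp: P)
    moreover have "1 / (\<gamma> * M) \<le> sqlen f \<gamma> C x y ?Z / D2 f \<gamma> C x y ?Z"
    proof -
      obtain t where t: "t \<in> {0..eps f \<gamma> C x y ?Z}" "D2 f \<gamma> C x y ?Z = hess (?P - t *\<^sub>R ?H) ?H"
        using D2_attained[OF Z] unfolding P by blast
      have pos: "?P - t *\<^sub>R ?H \<in> pos_couplings"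
        using segment_in_pos_couplings[OF Z t(1)] unfolding P .
      have "f'' ((?P - t *\<^sub>R ?H) $ i $ j) \<le> M" for i j
        using half_entry_le[OF Z t(1), of i j] ge[of i j] pos_couplingsD(3)[OF pos, of i j]
        by (intro M(2)) (auto simp: P)
      then have "D2 f \<gamma> C x y ?Z \<le> \<gamma> * M * (norm ?H)\<^sup>2"
        unfolding t(2) by (rule hess_le)
      moreover have "0 < D2 f \<gamma> C x y ?Z" using D2_pos[OF Z] nz by (simp add: P)
      ultimately show ?thesis
        using gamma_pos M(1) by (simp add: sqlen_eq[OF Z] P field_simps)
    qed
    ultimately show ?thesis by (auto simp: \<tau>_def step_def step_size_def)
  qed
  ultimately show ?thesis by (rule that)
qed

lemma F_tends_to_minimum:
  assumes R: "R \<in> couplings x y" and min: "\<And>P. P \<in> couplings x y \<Longrightarrow> F R \<le> F P"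
  shows "(\<lambda>n. F (iterate n)) \<longlonglongrightarrow> F R"
proof -
  obtain L where L: "(\<lambda>n. F (iterate n)) \<longlonglongrightarrow> L" "\<And>n. L \<le> F (iterate n)"
    using decseq_convergent[OF decseq_F, of "F R"] min[OF iterate_coupling] by metis
  have "F R \<le> L" using L(1) min[OF iterate_coupling] by (intro LIMSEQ_le_const) auto
  moreover have "\<not> F R < L"
  proof
    assume "F R < L"
    then have c: "0 < L - F R" "\<And>n. L - F R \<le> F (iterate n) - F R" using L(2) by auto
    \<comment> \<open>A coupling with vanishing Riemannian gradient is a minimizer, by convexity.\<close>
    have nz: "direction (iterate n) \<noteq> 0" for n
    proof
      assume "direction (iterate n) = 0"
      then have "grad (iterate n) \<bullet> (R - iterate n) = 0"
        using inner_direction[OF diff_couplings_tangent[OF R iterate_coupling]] by simp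
      then show False
        using F_above_tangent[OF iterate_pos R, of n] c(1) c(2)[of n] by linarith
    qed
    have "norm (iterate (Suc n) - iterate n) = step n * norm (direction (iterate n))" for n
      using step_bounds(1)[of n] by (simp add: iterate_Suc)
    then have "convergent iterate"
      using summable_step(2)[OF R c] by (intro convergent_if_summable_increments) simp
    then obtain Q where Q: "iterate \<longlonglongrightarrow> Q" by (auto simp: convergent_def)
    have Qpos: "Q \<in> pos_couplings" by (rule limit_in_pos_couplings[OF Q nz])
    define \<delta> where "\<delta> = Min (range (\<lambda>(i, j). Q $ i $ j)) / 2"
    have "0 < \<delta>"
      unfolding \<delta>_def using pos_couplingsD(2)[OF Qpos] by (subst half_gt_zero_iff, subst Min_gr_iff) auto
    have "Q $ i $ j \<in> range (\<lambda>(i, j). Q $ i $ j)" for i j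
      by (rule range_eqI[of _ _ "(i, j)"]) simp
    then have "2 * \<delta> \<le> Q $ i $ j" for i j
      unfolding \<delta>_def by simp
    then have less: "\<delta> < Q $ i $ j" for i j
      using \<open>0 < \<delta>\<close> by (smt (verit))
    have "eventually (\<lambda>n. \<delta> < iterate n $ i $ j) sequentially" for i j
      using less by (intro order_tendstoD(1)[of _ "Q $ i $ j"] tendsto_vec_nth Q)
    then have ev: "eventually (\<lambda>n. \<forall>i j. \<delta> < iterate n $ i $ j) sequentially"
      by (simp add: eventually_all_finite)
    obtain \<tau> where \<tau>: "0 < \<tau>" "\<And>n. (\<And>i j. \<delta> \<le> iterate n $ i $ j) \<Longrightarrow> \<tau> \<le> step n"
      using step_bounded_below[OF \<open>0 < \<delta>\<close> nz] by blast
    have "eventually (\<lambda>n. \<tau> \<le> step n) sequentially"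
      using ev by eventually_elim (auto intro: \<tau>(2) less_imp_le)
    moreover have "eventually (\<lambda>n. step n < \<tau>) sequentially"
      using summable_LIMSEQ_zero[OF summable_step(1)[OF R c]] \<tau>(1) by (rule order_tendstoD(2))
    ultimately have "eventually (\<lambda>n::nat. False) sequentially"
      by eventually_elim simp
    then show False by simp
  qed
  ultimately show ?thesis using L(1) by simp
qed

text \<open>
  By compactness the cost exceeds the minimum by a positive amount outside any ball around the unique
  minimizer.
\<close>

lemma iterate_tends_to_minimizer:
  assumes R: "R \<in> couplings x y" and min: "\<And>P. P \<in> couplings x y \<Longrightarrow> F R \<le> F P"
  shows "iterate \<longlonglongrightarrow> R"
proof (rule tendstoI)
  fix e :: real assume "0 < e"
  define K where "K = couplings x y - ball R e"
  have K: "compact K" "continuous_on K F"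
    unfolding K_def using compact_diff[OF compact_couplings open_ball]
      continuous_on_subset[OF continuous_on_F Diff_subset] by blast+
  show "eventually (\<lambda>n. dist (iterate n) R < e) sequentially"
  proof (cases "K = {}")
    case True
    then have "dist (iterate n) R < e" for n
      using iterate_coupling[of n] by (auto simp: K_def dist_commute)
    then show ?thesis by simp
  next
    case False
    then obtain Q where Q: "Q \<in> K" "\<And>P. P \<in> K \<Longrightarrow> F Q \<le> F P"
      using continuous_attains_inf[OF K(1) _ K(2)] by blast
    have QC: "Q \<in> couplings x y" "Q \<noteq> R" using Q(1) \<open>0 < e\<close> by (auto simp: K_def)
    have "F R < F Q"
    proof (rule ccontr)
      assume "\<not> F R < F Q"
      then have "(F Q + F R) / 2 \<le> F R" by simp
      then have "F ((1/2) *\<^sub>R Q + (1/2) *\<^sub>R R) < F R"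
        using F_strictly_convex[OF QC(1) R QC(2)] by (rule order.strict_trans2[rotated])
      moreover have "(1/2) *\<^sub>R Q + (1/2) *\<^sub>R R \<in> couplings x y"
        using convex_couplings QC(1) R by (rule convexD) auto
      ultimately show False using min by force
    qed
    with F_tends_to_minimum[OF R min] have "eventually (\<lambda>n. F (iterate n) < F Q) sequentially"
      by (rule order_tendstoD(2))
    then show ?thesis
    proof eventually_elim
      case (elim n)
      then have "iterate n \<notin> K" using Q(2)[of "iterate n"] by auto
      then show ?case using iterate_coupling[of n] by (simp add: K_def dist_commute)
    qed
  qed
qed

lemma descent_converges:
  obtains Z where "descent f \<gamma> C x y \<longlonglongrightarrow> Z" "is_f_coupling f \<gamma> C x y (Phi x y Z)"
proof -
  have "couplings x y \<noteq> {}" using pos_couplingsD(1)[OF outer_pos_coupling] by auto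
  then obtain R where R: "R \<in> couplings x y" "\<And>P. P \<in> couplings x y \<Longrightarrow> F R \<le> F P"
    using continuous_attains_inf[OF compact_couplings _ continuous_on_F] by blast
  have "(\<lambda>n. chart (iterate n)) \<longlonglongrightarrow> chart R"
    unfolding chart_def using iterate_tends_to_minimizer[OF R] by (intro tendsto_intros)
  then have "descent f \<gamma> C x y \<longlonglongrightarrow> chart R" by (simp add: iterate_def)
  moreover have "is_f_coupling f \<gamma> C x y (Phi x y (chart R))"
    unfolding Phi_chart[OF x_simplex y_simplex R(1)] is_f_coupling_def is_arg_min_linorder
    using R by blast
  ultimately show ?thesis by (rule that)
qed

end

lemma regularized_transportI:
  fixes f :: "real \<Rightarrow> real" and x y :: "real ^ ('n::finite) option"
  assumes "strictly_convex_on {0..1} f" "continuous_on {0..1} f" "C2_on {0<..1} f"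
    and "filterlim (deriv01 f) at_bot (at_right 0)" "0 < \<gamma>"
    and "x \<in> prob_simplex" "y \<in> prob_simplex"
    and "card (supp x) = CARD('n option)" "card (supp y) = CARD('n option)"
  obtains f' f'' where "regularized_transport f f' f'' \<gamma> x y"
proof -
  obtain f' f'' where d: "\<And>u. u \<in> {0<..1} \<Longrightarrow> (f has_real_derivative f' u) (at u within {0<..1})"
    "\<And>u. u \<in> {0<..1} \<Longrightarrow> (f' has_real_derivative f'' u) (at u within {0<..1})"
    "continuous_on {0<..1} f''"
    using assms(3) unfolding C2_on_def by blast
  have "deriv01 f u = f' u" if "0 < u" "u < 1" for u
  proof -
    have "(f has_real_derivative f' u) (at u)"
      using d(1)[of u] that at_within_open_subset[of u "{0<..<1}" "{0<..1}"]
      by (simp add: subset_iff)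
    then have "(f has_vector_derivative f' u) (at u within {0..1})"
      by (simp add: has_real_derivative_iff_has_vector_derivative has_vector_derivative_at_within)
    then show ?thesis
      unfolding deriv01_def using that
      by (intro vector_derivative_within_closed_interval[of 0 1]) auto
  qed
  then have "eventually (\<lambda>u. deriv01 f u = f' u) (at_right 0)"
    using eventually_at_right_real[of 0 1] by (auto elim!: eventually_mono)
  then have lim: "filterlim f' at_bot (at_right 0)"
    using assms(4) by (subst filterlim_cong[OF refl refl, symmetric])
  have supp: "0 < v $ i" if "card (supp v) = CARD('n option)" for v :: "real ^ 'n option" and i
  proof -
    have "supp v = UNIV" using that by (intro card_subset_eq) auto
    then show ?thesis by (auto simp: supp_def)
  qed
  have "regularized_transport f f' f'' \<gamma> x y"
    by unfold_locales (use assms d lim supp in auto)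
  then show ?thesis by (rule that)
qed

theorem corollary4p3:
  fixes f :: "real \<Rightarrow> real" and \<gamma> :: real
    and C :: "real ^ ('n::finite) option ^ ('n::finite) option" and x y :: "real ^ ('n::finite) option"
  assumes "strictly_convex_on {0..1} f"
    and "continuous_on {0..1} f"
    and "C2_on {0<..1} f"
    and "filterlim (deriv01 f) at_bot (at_right 0)"
    and "0 < \<gamma>"
    and "x \<in> prob_simplex" and "y \<in> prob_simplex"
    and "card (supp x) = CARD('n option)" and "card (supp y) = CARD('n option)"
  shows
    "(\<forall>Z \<in> coord_domain x y.
        (\<forall>t \<in> {0..eps f \<gamma> C x y Z}. Z - t *\<^sub>R rgrad f \<gamma> C x y Z \<in> coord_domain x y)
      \<and> (\<forall>t \<in> {0..eps f \<gamma> C x y Z}.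
            line_cost f \<gamma> C x y Z differentiable (at t)
          \<and> deriv (line_cost f \<gamma> C x y Z) differentiable (at t))
      \<and> (\<exists>t \<in> {0..eps f \<gamma> C x y Z}.
            D2 f \<gamma> C x y Z = deriv (deriv (line_cost f \<gamma> C x y Z)) t
          \<and> (\<forall>s \<in> {0..eps f \<gamma> C x y Z}.
               deriv (deriv (line_cost f \<gamma> C x y Z)) s \<le> D2 f \<gamma> C x y Z))
      \<and> 0 \<le> D2 f \<gamma> C x y Z
      \<and> (D2 f \<gamma> C x y Z = 0 \<longleftrightarrow> rgrad f \<gamma> C x y Z = 0))
    \<and> (\<forall>n. descent f \<gamma> C x y n \<in> coord_domain x y)
    \<and> Phi x y (descent f \<gamma> C x y 0) = outer x y
    \<and> (\<exists>Zinf. (\<lambda>n. descent f \<gamma> C x y n) \<longlonglongrightarrow> Zinf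
             \<and> is_f_coupling f \<gamma> C x y (Phi x y Zinf))"
proof -
  obtain f' f'' where "regularized_transport f f' f'' \<gamma> x y"
    using regularized_transportI[OF assms] .
  then interpret regularized_transport f f' f'' \<gamma> C x y .
  show ?thesis
  proof (intro conjI ballI allI)
    fix Z t assume Z: "Z \<in> coord_domain x y" and t: "t \<in> {0..eps f \<gamma> C x y Z}"
    show "Z - t *\<^sub>R rgrad f \<gamma> C x y Z \<in> coord_domain x y"
      by (rule segment_in_coord_domain[OF Z t])
    show "line_cost f \<gamma> C x y Z differentiable (at t)"
      "deriv (line_cost f \<gamma> C x y Z) differentiable (at t)"
      using deriv_line_cost[OF Z t] by (auto simp: real_differentiable_def)
  next
    fix Z assume Z: "Z \<in> coord_domain x y"
    show "\<exists>t \<in> {0..eps f \<gamma> C x y Z}. D2 f \<gamma> C x y Z = deriv (deriv (line_cost f \<gamma> C x y Z)) t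
          \<and> (\<forall>s \<in> {0..eps f \<gamma> C x y Z}. deriv (deriv (line_cost f \<gamma> C x y Z)) s \<le> D2 f \<gamma> C x y Z)"
      using D2_attained[OF Z] by (simp add: DERIV_imp_deriv[OF deriv_line_cost(2)[OF Z]])
    show "0 \<le> D2 f \<gamma> C x y Z" by (rule D2_nonneg[OF Z])
    show "D2 f \<gamma> C x y Z = 0 \<longleftrightarrow> rgrad f \<gamma> C x y Z = 0"
      by (simp add: D2_eq_0_iff[OF Z] rgrad_eq_0_iff[OF Z])
  next
    show "\<exists>Zinf. (\<lambda>n. descent f \<gamma> C x y n) \<longlonglongrightarrow> Zinf \<and> is_f_coupling f \<gamma> C x y (Phi x y Zinf)"
      using descent_converges by blast
  qed (rule descent_in_coord_domain Phi_descent_0)+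
qed

end
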